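(* Let $G$ be a finitely generated group that is hyperbolic relative to a collection $\Omega$ of (peripheral) subgroups, and assume $G$ is non-elementary. Let $S\subset G$ be a finite set generating $G$, let $\{H_1,\dots,H_r\}\subset\Omega$ be a complete set of representatives of the conjugacy classes in $\Omega$, and let $\ell$ be the word length on $G$ determined by the generating set $S\cup\bigcup_{1\le i\le r}H_i$. Let $\mu$ be an admissible probability measure on $G$, let $(Y_n)_{n\ge 0}$ be the right random walk on $G$ issued from the identity with increments distributed according to $\mu$, and let $I\colon\mathbb{R}_{\ge0}\to[0,\infty]$ be the convex rate function with which $\bigl(\frac1n\ell(Y_n)\bigr)_{n\ge1}$ satisfies the weak large deviation principle. Then: 1. If $\mu$ has a finite exponential moment, then $I$ is (topologically) a proper function and the sequence $\bigl(\frac1n\ell(Y_n)\bigr)_{n\ge1}$ satisfies the full large deviation principle with rate function $I$. 2. If $\mu$ has a finite moment generating function, then $I$ is the Fenchel-Legendre transform of the limiting logarithmic moment generating function $\Lambda$ of the sequence $\bigl(\frac1n\ell(Y_n)\bigr)_{n\ge1}$, that is, $I(x)=\sup_{t\in\mathbb{R}}\{tx-\Lambda(t)\}$ for every $x\in\mathbb{R}_{\ge0}$, where $\Lambda(t)=\limsup_{n\to\infty}\frac1n\log\mathbb{E}\bigl[e^{t\ell(Y_n)}\bigr]$ for $t\in\mathbb{R}$.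
   Context: **Groups.** $G$ is non-elementary if it contains no cyclic subgroup of finite index. $e$ denotes the identity. The collection $\Omega$ of subgroups of $G$ is closed under conjugation by elements of $G$ and has finitely many conjugacy classes; $\{H_1,\dots,H_r\}$ contains one representative of each class. The word length is $\ell(e)=0$ and, for $g\ne e$, $\ell(g)=\inf\{n\ge 1:\ g=x_1\cdots x_n \text{ for some } x_1,\dots,x_n\in S\cup S^{-1}\cup\bigcup_{i}H_i\}$. **Relative hyperbolicity.** Let $\mathrm{Cay}(G,S)$ be the Cayley graph with respect to $S$, with graph distance $d'$, and let $\mathrm{Cay}(G,S\cup\bigcup_i H_i)$ be the Cayley graph with respect to $S\cup\bigcup_i H_i$, with graph distance $d$. Let $\Gamma$ be the geodesic metric space obtained from the latter by identifying every edge with the unit interval. $G$ is weakly relatively hyperbolic with respect to $\Omega$ if $\Gamma$ is a Gromov-hyperbolic metric space (this is independent of the choices of $S$ and of the $H_i$). A path is a finite sequence $(\gamma_1,\dots,\gamma_n)$ of successively adjacent vertices of $\mathrm{Cay}(G,S\cup\bigcup_i H_i)$. For $\lambda,c>0$ it is a relative $(\lambda,c)$-quasi geodesic path if $\lambda^{-1}|k-l|-c\le d(\gamma_k,\gamma_l)\le\lambda|k-l|+c$ for all $k,l\in\{1,\dots,n\}$. A path enters the left coset $gH_i$ if it has a vertex in $gH_i$ followed by an edge corresponding to an element of $H_i$. For such a path, a maximal subpath consisting of vertices in $gH_i$ and with edges labelled by elements of $H_i$ is called an $H_i$-component; its first and last vertices are the entering point and the exit point, and the path leaves $gH_i$ at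 the exit point. The path travels more than $R$ in $gH_i$ if the $d'$-distance between entering and exit point is larger than $R$. A path is without backtracking if it never goes back to a coset $gH_i$ once it has left it. The pair $(G,\Omega)$ satisfies the Bounded Coset Penetration property if for all $\lambda,c>0$ there is a constant $C_{\lambda,c}$ such that for every pair $(\alpha_1,\alpha_2)$ of relative $(\lambda,c)$-quasi geodesic paths without backtracking and with common end points: (1) if $\alpha_1$ travels more than $C_{\lambda,c}$ in a coset $gH_i$, then $\alpha_2$ enters $gH_i$; (2) if $\alpha_1$ and $\alpha_2$ enter the same coset $gH_i$, the two entering points and the two exit points are $C_{\lambda,c}$-close to each other in $\mathrm{Cay}(G,S)$. $G$ is hyperbolic relative to $\Omega$ if it is weakly relatively hyperbolic with respect to $\Omega$ and $(G,\Omega)$ satisfies the Bounded Coset Penetration property. **Random walk.** $G$ is viewed as a discrete group; a probability measure is a function $\mu\colon G\to[0,1]$ with $\sum_{g}\mu(g)=1$. Let $(X_i)_{i\ge 1}$ be independent $G$-valued random variables with law $\mu$; the right random walk issued from the identity is $Y_0=e$, $Y_n=X_1\cdots X_n$ for $n\ge1$. $\mu$ is admissible if for every $g\in G$ there is $n\ge 1$ with $\mathbb{P}(Y_n=g)>0$; equivalently, $\{g\in G:\mu(g)>0\}$ generates $G$ as a semigroup. $\mu$ has a finite exponential moment if there is $\tau>0$ with $\int_G\exp(\tau\ell(g))\,d\mu(g)<\infty$; it has a finite moment generating function if $\int_G\exp(\tau\ell(g))\,d\mu(g)<\infty$ for every $\tau>0$. **Large deviations.** Let $X$ be a Hausdorff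 regular topological space, $I\colon X\to[0,\infty]$ a lower semicontinuous function (rate function), and $(\mu_n)_{n\ge1}$ Borel probability measures on $X$. The sequence satisfies the full large deviation principle with rate function $I$ if for every Borel set $\Lambda\subset X$ $$-\inf_{x\in\Lambda^\circ}I(x)\le\liminf_{n\to\infty}\tfrac1n\log\mu_n(\Lambda)\le\limsup_{n\to\infty}\tfrac1n\log\mu_n(\Lambda)\le-\inf_{x\in\overline\Lambda}I(x),$$ where $\Lambda^\circ$ and $\overline\Lambda$ are the interior and closure of $\Lambda$ (conventions: $\log 0=-\infty$, $\inf\emptyset=\infty$). It satisfies the weak large deviation principle with rate function $I$ if this holds for every Borel $\Lambda$ with compact closure. A sequence of random variables satisfies the principle if the sequence of their laws does. Here $X=\mathbb{R}_{\ge0}$. It is established, under the standing assumptions of the claim and with no moment assumption on $\mu$, that $\bigl(\frac1n\ell(Y_n)\bigr)_{n\ge1}$ satisfies the weak large deviation principle with a convex rate function $I$; it is given by $I(x)=\sup_{V}\bigl(-\liminf_{n}\frac1n\log\mathbb{P}(\frac1n\ell(Y_n)\in V)\bigr)$, the supremum being over open $V\subset\mathbb{R}_{\ge0}$ containing $x$. That $I$ is (topologically) proper means that its sublevel sets $\{x: I(x)\le a\}$, $a\in[0,\infty)$, are compact. *)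

theory Defs
  imports
    "HOL-Algebra.Coset"
    "HOL-Algebra.Generated_Groups"
    "HOL-Probability.Probability"
begin

section \<open>Groups with a collection of peripheral subgroups\<close>

definition non_elementary :: "('a, 'b) monoid_scheme \<Rightarrow> bool" where
  "non_elementary G \<longleftrightarrow>
     \<not> (\<exists>g\<in>carrier G. finite (rcosets\<^bsub>G\<^esub> (generate G {g})))"

definition conj_subgroup :: "('a, 'b) monoid_scheme \<Rightarrow> 'a \<Rightarrow> 'a set \<Rightarrow> 'a set" where
  "conj_subgroup G g H = (g <#\<^bsub>G\<^esub> H) #>\<^bsub>G\<^esub> (inv\<^bsub>G\<^esub> g)"

definition conj_class :: "('a, 'b) monoid_scheme \<Rightarrow> 'a set \<Rightarrow> 'a set set" where
  "conj_class G H = (\<lambda>g. conj_subgroup G g H) ` carrier G"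

definition peripheral_collection :: "('a, 'b) monoid_scheme \<Rightarrow> 'a set set \<Rightarrow> bool" where
  "peripheral_collection G \<O> \<longleftrightarrow>
     (\<forall>H\<in>\<O>. subgroup H G) \<and>
     (\<forall>H\<in>\<O>. conj_class G H \<subseteq> \<O>) \<and>
     finite (conj_class G ` \<O>)"

text \<open>The set \<open>\<H>\<close> plays the role of \<open>{H\<^sub>1, \<dots>, H\<^sub>r}\<close>.\<close>

definition conj_representatives ::
    "('a, 'b) monoid_scheme \<Rightarrow> 'a set set \<Rightarrow> 'a set set \<Rightarrow> bool" where
  "conj_representatives G \<O> \<H> \<longleftrightarrow>
     \<H> \<subseteq> \<O> \<and> (\<forall>K\<in>\<O>. \<exists>!H. H \<in> \<H> \<and> H \<in> conj_class G K)"

definition finite_generating_set :: "('a, 'b) monoid_scheme \<Rightarrow> 'a set \<Rightarrow> bool" where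
  "finite_generating_set G S \<longleftrightarrow> finite S \<and> S \<subseteq> carrier G \<and> generate G S = carrier G"

definition word_length ::
    "('a, 'b) monoid_scheme \<Rightarrow> 'a set \<Rightarrow> 'a set set \<Rightarrow> 'a \<Rightarrow> nat" where
  "word_length G S \<H> g =
     (if g = \<one>\<^bsub>G\<^esub> then 0
      else Inf {n. n \<ge> 1 \<and> (\<exists>xs. length xs = n \<and>
                  set xs \<subseteq> S \<union> m_inv G ` S \<union> \<Union>\<H> \<and>
                  g = foldr (\<otimes>\<^bsub>G\<^esub>) xs \<one>\<^bsub>G\<^esub>)})"


section \<open>Cayley graphs and their geometric realizations\<close>

text \<open>Cayley graphs are simple undirected graphs, given by a symmetric irreflexive edge relation.
  The step from \<open>u\<close> to \<open>v\<close> along an edge corresponds to the group element \<open>u\<^sup>-\<^sup>1v\<close>.\<close>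

definition cayley :: "('a, 'b) monoid_scheme \<Rightarrow> 'a set \<Rightarrow> ('a \<times> 'a) set" where
  "cayley G A = {(u, v). u \<in> carrier G \<and> v \<in> carrier G \<and> u \<noteq> v \<and>
     (inv\<^bsub>G\<^esub> u \<otimes>\<^bsub>G\<^esub> v \<in> A \<or> inv\<^bsub>G\<^esub> v \<otimes>\<^bsub>G\<^esub> u \<in> A)}"

definition graph_dist :: "('a \<times> 'a) set \<Rightarrow> 'a \<Rightarrow> 'a \<Rightarrow> nat" where
  "graph_dist E u v = (LEAST n. (u, v) \<in> E ^^ n)"

text \<open>Points of the geometric realization in barycentric coordinates: \<open>edge_point u v t\<close> lies on the
  edge \<open>uv\<close> at distance \<open>t\<close> from \<open>u\<close>, and \<open>edge_point u u t\<close> is the vertex \<open>u\<close>.  This makes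
  the identifications automatic, e.g. \<open>edge_point u v t = edge_point v u (1 - t)\<close>.\<close>

definition edge_point :: "'a \<Rightarrow> 'a \<Rightarrow> real \<Rightarrow> ('a \<Rightarrow> real)" where
  "edge_point u v t = (\<lambda>x. (1 - t) * indicator {u} x + t * indicator {v} x)"

definition realization :: "'a set \<Rightarrow> ('a \<times> 'a) set \<Rightarrow> ('a \<Rightarrow> real) set" where
  "realization V E = {edge_point u v t | u v t. (u, v) \<in> E \<union> Id_on V \<and> t \<in> {0..1}}"

text \<open>The path metric of the realization, every edge having length one: two points are joined
  either inside a common edge or through an end vertex of the edge of each of them.  Each point has
  several representations, by orientation of its edge and, for vertices, by choice of an edge; the
  infimum takes care of them.\<close>

definition realization_dist ::
    "'a set \<Rightarrow> ('a \<times> 'a) set \<Rightarrow> ('a \<Rightarrow> real) \<Rightarrow> ('a \<Rightarrow> real) \<Rightarrow> real" where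
  "realization_dist V E p q = Inf
     ({\<bar>s - t\<bar> | u v s t. (u, v) \<in> E \<union> Id_on V \<and> s \<in> {0..1} \<and> t \<in> {0..1} \<and>
         p = edge_point u v s \<and> q = edge_point u v t} \<union>
      {s + real (graph_dist E u u') + t | u v s u' v' t.
         (u, v) \<in> E \<union> Id_on V \<and> (u', v') \<in> E \<union> Id_on V \<and> s \<in> {0..1} \<and> t \<in> {0..1} \<and>
         p = edge_point u v s \<and> q = edge_point u' v' t})"

definition gromov_product :: "('p \<Rightarrow> 'p \<Rightarrow> real) \<Rightarrow> 'p \<Rightarrow> 'p \<Rightarrow> 'p \<Rightarrow> real" where
  "gromov_product d w x y = (d x w + d y w - d x y) / 2"

definition gromov_hyperbolic :: "'p set \<Rightarrow> ('p \<Rightarrow> 'p \<Rightarrow> real) \<Rightarrow> bool" where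
  "gromov_hyperbolic X d \<longleftrightarrow>
     (\<exists>\<delta>\<ge>0. \<forall>w\<in>X. \<forall>x\<in>X. \<forall>y\<in>X. \<forall>z\<in>X.
        gromov_product d w x z \<ge> min (gromov_product d w x y) (gromov_product d w y z) - \<delta>)"


section \<open>Relative hyperbolicity\<close>

abbreviation rel_cayley :: "('a, 'b) monoid_scheme \<Rightarrow> 'a set \<Rightarrow> 'a set set \<Rightarrow> ('a \<times> 'a) set" where
  "rel_cayley G S \<H> \<equiv> cayley G (S \<union> \<Union>\<H>)"

definition weakly_rel_hyperbolic ::
    "('a, 'b) monoid_scheme \<Rightarrow> 'a set \<Rightarrow> 'a set set \<Rightarrow> bool" where
  "weakly_rel_hyperbolic G S \<H> \<longleftrightarrow>
     gromov_hyperbolic (realization (carrier G) (rel_cayley G S \<H>))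
       (realization_dist (carrier G) (rel_cayley G S \<H>))"

definition rel_path :: "('a, 'b) monoid_scheme \<Rightarrow> 'a set \<Rightarrow> 'a set set \<Rightarrow> 'a list \<Rightarrow> bool" where
  "rel_path G S \<H> \<gamma> \<longleftrightarrow> \<gamma> \<noteq> [] \<and> set \<gamma> \<subseteq> carrier G \<and>
     successively (\<lambda>u v. (u, v) \<in> rel_cayley G S \<H>) \<gamma>"

definition rel_quasi_geodesic ::
    "('a, 'b) monoid_scheme \<Rightarrow> 'a set \<Rightarrow> 'a set set \<Rightarrow> real \<Rightarrow> real \<Rightarrow> 'a list \<Rightarrow> bool" where
  "rel_quasi_geodesic G S \<H> lam c \<gamma> \<longleftrightarrow> rel_path G S \<H> \<gamma> \<and>
     (\<forall>k<length \<gamma>. \<forall>l<length \<gamma>.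
        \<bar>real k - real l\<bar> / lam - c \<le> real (graph_dist (rel_cayley G S \<H>) (\<gamma> ! k) (\<gamma> ! l)) \<and>
        real (graph_dist (rel_cayley G S \<H>) (\<gamma> ! k) (\<gamma> ! l)) \<le> lam * \<bar>real k - real l\<bar> + c)"

text \<open>Below, \<open>g\<close> and \<open>H\<close> stand for the left coset \<open>gH\<close>.  The coset determines \<open>H\<close>.\<close>

definition enters :: "('a, 'b) monoid_scheme \<Rightarrow> 'a \<Rightarrow> 'a set \<Rightarrow> 'a list \<Rightarrow> bool" where
  "enters G g H \<gamma> \<longleftrightarrow> (\<exists>k. Suc k < length \<gamma> \<and>
     \<gamma> ! k \<in> g <#\<^bsub>G\<^esub> H \<and> inv\<^bsub>G\<^esub> (\<gamma> ! k) \<otimes>\<^bsub>G\<^esub> (\<gamma> ! Suc k) \<in> H)"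

text \<open>Subpaths are given by the indices \<open>i < j\<close> of their first and last vertices.\<close>

definition in_coset ::
    "('a, 'b) monoid_scheme \<Rightarrow> 'a \<Rightarrow> 'a set \<Rightarrow> 'a list \<Rightarrow> nat \<Rightarrow> nat \<Rightarrow> bool" where
  "in_coset G g H \<gamma> i j \<longleftrightarrow> i < j \<and> j < length \<gamma> \<and>
     (\<forall>k\<in>{i..j}. \<gamma> ! k \<in> g <#\<^bsub>G\<^esub> H) \<and>
     (\<forall>k\<in>{i..<j}. inv\<^bsub>G\<^esub> (\<gamma> ! k) \<otimes>\<^bsub>G\<^esub> (\<gamma> ! Suc k) \<in> H)"

definition coset_component ::
    "('a, 'b) monoid_scheme \<Rightarrow> 'a \<Rightarrow> 'a set \<Rightarrow> 'a list \<Rightarrow> nat \<Rightarrow> nat \<Rightarrow> bool" where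
  "coset_component G g H \<gamma> i j \<longleftrightarrow> in_coset G g H \<gamma> i j \<and>
     (\<forall>i' j'. i' \<le> i \<and> j \<le> j' \<and> in_coset G g H \<gamma> i' j' \<longrightarrow> i' = i \<and> j' = j)"

definition travels_more_than ::
    "('a, 'b) monoid_scheme \<Rightarrow> 'a set \<Rightarrow> real \<Rightarrow> 'a \<Rightarrow> 'a set \<Rightarrow> 'a list \<Rightarrow> bool" where
  "travels_more_than G S R g H \<gamma> \<longleftrightarrow> (\<exists>i j. coset_component G g H \<gamma> i j \<and>
     real (graph_dist (cayley G S) (\<gamma> ! i) (\<gamma> ! j)) > R)"

definition without_backtracking ::
    "('a, 'b) monoid_scheme \<Rightarrow> 'a set set \<Rightarrow> 'a list \<Rightarrow> bool" where
  "without_backtracking G \<H> \<gamma> \<longleftrightarrow>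
     (\<forall>H\<in>\<H>. \<forall>g\<in>carrier G. \<forall>i j k. coset_component G g H \<gamma> i j \<and> j < k \<and> k < length \<gamma>
        \<longrightarrow> \<gamma> ! k \<notin> g <#\<^bsub>G\<^esub> H)"

definition bounded_coset_penetration ::
    "('a, 'b) monoid_scheme \<Rightarrow> 'a set \<Rightarrow> 'a set set \<Rightarrow> bool" where
  "bounded_coset_penetration G S \<H> \<longleftrightarrow>
     (\<forall>lam>0. \<forall>c>0. \<exists>C::real. \<forall>\<alpha>\<^sub>1 \<alpha>\<^sub>2.
        rel_quasi_geodesic G S \<H> lam c \<alpha>\<^sub>1 \<and> without_backtracking G \<H> \<alpha>\<^sub>1 \<and>
        rel_quasi_geodesic G S \<H> lam c \<alpha>\<^sub>2 \<and> without_backtracking G \<H> \<alpha>\<^sub>2 \<and>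
        hd \<alpha>\<^sub>1 = hd \<alpha>\<^sub>2 \<and> last \<alpha>\<^sub>1 = last \<alpha>\<^sub>2 \<longrightarrow>
        (\<forall>H\<in>\<H>. \<forall>g\<in>carrier G.
           (travels_more_than G S C g H \<alpha>\<^sub>1 \<longrightarrow> enters G g H \<alpha>\<^sub>2) \<and>
           (\<forall>i\<^sub>1 j\<^sub>1 i\<^sub>2 j\<^sub>2.
              coset_component G g H \<alpha>\<^sub>1 i\<^sub>1 j\<^sub>1 \<and> coset_component G g H \<alpha>\<^sub>2 i\<^sub>2 j\<^sub>2 \<longrightarrow>
              real (graph_dist (cayley G S) (\<alpha>\<^sub>1 ! i\<^sub>1) (\<alpha>\<^sub>2 ! i\<^sub>2)) \<le> C \<and>
              real (graph_dist (cayley G S) (\<alpha>\<^sub>1 ! j\<^sub>1) (\<alpha>\<^sub>2 ! j\<^sub>2)) \<le> C)))"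

text \<open>Relative hyperbolicity does not depend on the choice of \<open>S\<close> and \<open>\<H>\<close>, so that
  asking it for some choice or for all choices amounts to the same.\<close>

definition hyperbolic_relative_to :: "('a, 'b) monoid_scheme \<Rightarrow> 'a set set \<Rightarrow> bool" where
  "hyperbolic_relative_to G \<O> \<longleftrightarrow> peripheral_collection G \<O> \<and>
     (\<exists>S \<H>. finite_generating_set G S \<and> conj_representatives G \<O> \<H> \<and>
        weakly_rel_hyperbolic G S \<H> \<and> bounded_coset_penetration G S \<H>)"


section \<open>Random walks\<close>

primrec random_walk ::
    "('a, 'b) monoid_scheme \<Rightarrow> (nat \<Rightarrow> 'w \<Rightarrow> 'a) \<Rightarrow> nat \<Rightarrow> 'w \<Rightarrow> 'a" where
  "random_walk G X 0 \<omega> = \<one>\<^bsub>G\<^esub>"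
| "random_walk G X (Suc n) \<omega> = random_walk G X n \<omega> \<otimes>\<^bsub>G\<^esub> X (Suc n) \<omega>"

text \<open>\<open>X\<^sub>1, X\<^sub>2, \<dots>\<close> are independent with law \<open>\<mu>\<close>; the value \<open>X\<^sub>0\<close> is irrelevant.\<close>

definition iid_increments ::
    "('a, 'b) monoid_scheme \<Rightarrow> 'a pmf \<Rightarrow> 'w measure \<Rightarrow> (nat \<Rightarrow> 'w \<Rightarrow> 'a) \<Rightarrow> bool" where
  "iid_increments G \<mu> M X \<longleftrightarrow> prob_space M \<and>
     prob_space.indep_vars M (\<lambda>_. count_space (carrier G)) X {1..} \<and>
     (\<forall>i\<ge>1. distributed M (count_space (carrier G)) (X i) (\<lambda>g. ennreal (pmf \<mu> g)))"

text \<open>Admissibility of the law \<open>\<mu>\<close> of the increments, expressed through the walk they drive.\<close>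

definition admissible ::
    "('a, 'b) monoid_scheme \<Rightarrow> 'w measure \<Rightarrow> (nat \<Rightarrow> 'w \<Rightarrow> 'a) \<Rightarrow> bool" where
  "admissible G M X \<longleftrightarrow>
     (\<forall>g\<in>carrier G. \<exists>n\<ge>1. measure M {\<omega>\<in>space M. random_walk G X n \<omega> = g} > 0)"

definition finite_exponential_moment :: "'a pmf \<Rightarrow> ('a \<Rightarrow> nat) \<Rightarrow> bool" where
  "finite_exponential_moment \<mu> len \<longleftrightarrow>
     (\<exists>\<tau>>0. (\<integral>\<^sup>+ g. ennreal (exp (\<tau> * real (len g))) \<partial>measure_pmf \<mu>) < \<infinity>)"

definition finite_moment_generating_function :: "'a pmf \<Rightarrow> ('a \<Rightarrow> nat) \<Rightarrow> bool" where
  "finite_moment_generating_function \<mu> len \<longleftrightarrow>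
     (\<forall>\<tau>>0. (\<integral>\<^sup>+ g. ennreal (exp (\<tau> * real (len g))) \<partial>measure_pmf \<mu>) < \<infinity>)"


section \<open>Large deviations\<close>

definition elog :: "ennreal \<Rightarrow> ereal" where
  "elog x = (if x = 0 then -\<infinity> else if x = \<infinity> then \<infinity> else ereal (ln (enn2real x)))"

definition borel_of :: "'x topology \<Rightarrow> 'x measure" where
  "borel_of T = sigma (topspace T) {U. openin T U}"

text \<open>Lower semicontinuity is stated as closedness of the sublevel sets.\<close>

definition rate_function :: "'x topology \<Rightarrow> ('x \<Rightarrow> ereal) \<Rightarrow> bool" where
  "rate_function T I \<longleftrightarrow> (\<forall>x\<in>topspace T. 0 \<le> I x) \<and>
     (\<forall>a::ereal. closedin T {x\<in>topspace T. I x \<le> a})"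

definition proper_rate :: "'x topology \<Rightarrow> ('x \<Rightarrow> ereal) \<Rightarrow> bool" where
  "proper_rate T I \<longleftrightarrow> (\<forall>a::real. a \<ge> 0 \<longrightarrow> compactin T {x\<in>topspace T. I x \<le> ereal a})"

definition ldp_bounds ::
    "'x topology \<Rightarrow> (nat \<Rightarrow> 'x measure) \<Rightarrow> ('x \<Rightarrow> ereal) \<Rightarrow> 'x set \<Rightarrow> bool" where
  "ldp_bounds T \<nu> I \<Lambda> \<longleftrightarrow>
     - (INF x\<in>T interior_of \<Lambda>. I x) \<le> liminf (\<lambda>n. ereal (1 / real n) * elog (emeasure (\<nu> n) \<Lambda>)) \<and>
     limsup (\<lambda>n. ereal (1 / real n) * elog (emeasure (\<nu> n) \<Lambda>)) \<le> - (INF x\<in>T closure_of \<Lambda>. I x)"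

definition full_ldp :: "'x topology \<Rightarrow> (nat \<Rightarrow> 'x measure) \<Rightarrow> ('x \<Rightarrow> ereal) \<Rightarrow> bool" where
  "full_ldp T \<nu> I \<longleftrightarrow> rate_function T I \<and> (\<forall>\<Lambda>\<in>sets (borel_of T). ldp_bounds T \<nu> I \<Lambda>)"

definition weak_ldp :: "'x topology \<Rightarrow> (nat \<Rightarrow> 'x measure) \<Rightarrow> ('x \<Rightarrow> ereal) \<Rightarrow> bool" where
  "weak_ldp T \<nu> I \<longleftrightarrow> rate_function T I \<and>
     (\<forall>\<Lambda>\<in>sets (borel_of T). compactin T (T closure_of \<Lambda>) \<longrightarrow> ldp_bounds T \<nu> I \<Lambda>)"

abbreviation nonneg_reals :: "real topology" where
  "nonneg_reals \<equiv> top_of_set {0..}"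

definition convex_rate :: "(real \<Rightarrow> ereal) \<Rightarrow> bool" where
  "convex_rate I \<longleftrightarrow> (\<forall>x\<ge>0. \<forall>y\<ge>0. \<forall>s\<in>{0..1}.
     I ((1 - s) * x + s * y) \<le> ereal (1 - s) * I x + ereal s * I y)"

text \<open>The law of \<open>\<ell>(Y\<^sub>n) / n\<close> on \<open>[0,\<infinity>)\<close>, with \<open>len\<close> in the role of \<open>\<ell>\<close>
  and \<open>Y\<close> in the role of the walk; only \<open>n \<ge> 1\<close> matters.\<close>

definition normalized_length_law ::
    "'w measure \<Rightarrow> ('a \<Rightarrow> nat) \<Rightarrow> (nat \<Rightarrow> 'w \<Rightarrow> 'a) \<Rightarrow> nat \<Rightarrow> real measure" where
  "normalized_length_law M len Y n =
     distr M (borel_of nonneg_reals) (\<lambda>\<omega>. real (len (Y n \<omega>)) / real n)"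

definition limiting_log_mgf ::
    "'w measure \<Rightarrow> ('a \<Rightarrow> nat) \<Rightarrow> (nat \<Rightarrow> 'w \<Rightarrow> 'a) \<Rightarrow> real \<Rightarrow> ereal" where
  "limiting_log_mgf M len Y t =
     limsup (\<lambda>n. ereal (1 / real n) *
       elog (\<integral>\<^sup>+ \<omega>. ennreal (exp (t * real (len (Y n \<omega>)))) \<partial>M))"

end

theory Submission
  imports Defs
begin

text \<open>Subadditivity of the length and independence bound the exponential moments of \<open>\<ell>(Y\<^sub>n)\<close>
  by the \<open>n\<close>-th power of those of \<open>\<mu>\<close>, so that Chebyshev's inequality yields exponential tightness;
  this upgrades the weak principle to a full one with proper rate function.  If all exponential
  moments are finite, the given lower bounds and Varadhan's lemma relate \<open>\<Lambda>\<close> to the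
  Legendre transform of \<open>I\<close>, and convexity of \<open>I\<close> allows one to invert the transform.\<close>

text \<open>The identity \<Lambda> = I* is never proved and no abstract biconjugation is invoked;
  two one-sided estimates are enough. The bound t x - \<Lambda>(t) \<le> I x comes from the lower
  bound near x alone. Conversely, a real a < I x yields an affine minorant t y - c of I with c = t x
  - a, and the Laplace upper bound for this single line gives \<Lambda>(t) \<le> c, that is t x -
  \<Lambda>(t) \<ge> a. The weak principle sees only relatively compact sets, so the mass beyond a
  large R has to be removed by hand: a moment of order u > t makes its contribution smaller than any
  prescribed exponential rate. The case t = 0 is exponential tightness, hence one exponential moment
  gives the first part, while the second runs through all real t. Infinite logarithms and infinite
  values of I are kept out of the calculations: inequalities are tested against real bounds and
  rewritten as a n \<le> exp(n(c + \<epsilon>)) for large n.\<close>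

section \<open>Exponential rates\<close>

text \<open>Comparison with real \<open>y\<close> determines an extended real, so this equivalence
  replaces arithmetic with infinite logarithms. At n = 0 it fails, because \<open>1 / 0 = 0\<close>
  makes the left side 0 \<le> y.\<close>

lemma scaled_elog_le_iff:
  assumes "n > 0"
  shows "ereal (1 / real n) * elog a \<le> ereal y \<longleftrightarrow> a \<le> ennreal (exp (real n * y))"
proof (cases a)
  case (real r)
  show ?thesis
  proof (cases "r = 0")
    case True
    then show ?thesis using real assms by (simp add: elog_def)
  next
    case False
    with real have r: "r > 0" by simp
    then have "ereal (1 / real n) * elog a = ereal (ln r / real n)"
      using real by (simp add: elog_def)
    moreover have "ln r / real n \<le> y \<longleftrightarrow> r \<le> exp (real n * y)"
      using assms r by (simp add: field_simps ln_le_cancel_iff[symmetric] flip: ln_ge_iff)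
    ultimately show ?thesis using real r by (simp add: ennreal_le_iff)
  qed
next
  case top
  then show ?thesis using assms by (simp add: elog_def top_unique)
qed

lemma elog_mono: "a \<le> b \<Longrightarrow> elog a \<le> elog b"
proof (rule ereal_le_real)
  fix z assume "a \<le> b" "elog b \<le> ereal z"
  with scaled_elog_le_iff[of 1 b z] scaled_elog_le_iff[of 1 a z] show "elog a \<le> ereal z"
    by (auto simp flip: one_ereal_def)
qed

lemma scaled_elog_mono: "a \<le> b \<Longrightarrow> ereal (1 / real n) * elog a \<le> ereal (1 / real n) * elog b"
  by (intro ereal_mult_left_mono elog_mono) auto

lemma limsup_elog_mono:
  assumes "eventually (\<lambda>n. a n \<le> b n) sequentially"
  shows "limsup (\<lambda>n. ereal (1 / real n) * elog (a n)) \<le> limsup (\<lambda>n. ereal (1 / real n) * elog (b n))"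
  using assms by (intro Limsup_mono) (auto elim!: eventually_mono intro: scaled_elog_mono)

lemma liminf_elog_mono:
  assumes "eventually (\<lambda>n. a n \<le> b n) sequentially"
  shows "liminf (\<lambda>n. ereal (1 / real n) * elog (a n)) \<le> liminf (\<lambda>n. ereal (1 / real n) * elog (b n))"
  using assms by (intro Liminf_mono) (auto elim!: eventually_mono intro: scaled_elog_mono)

text \<open>The slack \<epsilon> is unavoidable, since the terms may approach \<open>c\<close> from
  above. The right side can be added and multiplied in \<open>ennreal\<close> without case
  distinctions.\<close>

lemma limsup_elog_le_iff:
  "limsup (\<lambda>n. ereal (1 / real n) * elog (a n)) \<le> ereal c \<longleftrightarrow>
     (\<forall>\<epsilon>>0. \<forall>\<^sub>F n in sequentially. a n \<le> ennreal (exp (real n * (c + \<epsilon>))))"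
    (is "?L \<longleftrightarrow> ?R")
proof
  assume L: ?L
  show ?R
  proof (intro allI impI)
    fix \<epsilon> :: real assume "\<epsilon> > 0"
    then have "\<forall>\<^sub>F n in sequentially. ereal (1 / real n) * elog (a n) < ereal (c + \<epsilon>)"
      using L unfolding Limsup_le_iff by auto
    then show "\<forall>\<^sub>F n in sequentially. a n \<le> ennreal (exp (real n * (c + \<epsilon>)))"
      using eventually_gt_at_top[of 0] by eventually_elim (auto simp: scaled_elog_le_iff[symmetric])
  qed
next
  assume R: ?R
  show ?L
  proof (rule ereal_le_epsilon2)
    fix \<epsilon> :: real assume "\<epsilon> > 0"
    with R have "\<forall>\<^sub>F n in sequentially. a n \<le> ennreal (exp (real n * (c + \<epsilon>)))" by blast
    then have "\<forall>\<^sub>F n in sequentially. ereal (1 / real n) * elog (a n) \<le> ereal (c + \<epsilon>)"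
      using eventually_gt_at_top[of 0] by eventually_elim (simp add: scaled_elog_le_iff)
    then show "limsup (\<lambda>n. ereal (1 / real n) * elog (a n)) \<le> ereal c + ereal \<epsilon>"
      by (simp add: Limsup_bounded)
  qed
qed

text \<open>A sum is at most twice the larger summand, and a constant factor does not change an
  exponential rate.\<close>

lemma limsup_elog_add_le:
  assumes "limsup (\<lambda>n. ereal (1 / real n) * elog (a n)) \<le> C"
    and "limsup (\<lambda>n. ereal (1 / real n) * elog (b n)) \<le> C"
  shows "limsup (\<lambda>n. ereal (1 / real n) * elog (a n + b n)) \<le> C"
proof (rule ereal_le_real)
  fix c assume "C \<le> ereal c"
  with assms have le: "limsup (\<lambda>n. ereal (1 / real n) * elog (a n)) \<le> ereal c"
    "limsup (\<lambda>n. ereal (1 / real n) * elog (b n)) \<le> ereal c"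
    by (auto intro: order_trans)
  show "limsup (\<lambda>n. ereal (1 / real n) * elog (a n + b n)) \<le> ereal c"
    unfolding limsup_elog_le_iff
  proof (intro allI impI)
    fix \<epsilon> :: real assume "\<epsilon> > 0"
    \<comment> \<open>One half of \<epsilon> is spent on the two given rates, the other half absorbs
      the factor 2 once n \<ge> 2 ln 2 / \<epsilon>.\<close>
    then have "\<epsilon> / 2 > 0" by simp
    have ev2: "\<forall>\<^sub>F n in sequentially. real n \<ge> 2 * ln 2 / \<epsilon>"
      using filterlim_real_sequentially by (auto simp: filterlim_at_top)
    show "\<forall>\<^sub>F n in sequentially. a n + b n \<le> ennreal (exp (real n * (c + \<epsilon>)))"
      using le[unfolded limsup_elog_le_iff, rule_format, OF \<open>\<epsilon> / 2 > 0\<close>] ev2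
    proof eventually_elim
      case (elim n)
      have "a n + b n \<le> ennreal (2 * exp (real n * (c + \<epsilon> / 2)))"
        using add_mono[OF elim(1,2)] by (simp flip: ennreal_plus)
      also have "ln 2 \<le> real n * \<epsilon> / 2" using elim(3) \<open>\<epsilon> > 0\<close> by (simp add: field_simps)
      then have "(2::real) \<le> exp (real n * \<epsilon> / 2)" by (metis exp_le_cancel_iff exp_ln zero_less_numeral)
      then have "2 * exp (real n * (c + \<epsilon> / 2)) \<le> exp (real n * \<epsilon> / 2) * exp (real n * (c + \<epsilon> / 2))"
        by (intro mult_right_mono) auto
      also have "\<dots> = exp (real n * (c + \<epsilon>))" by (simp add: exp_add[symmetric] algebra_simps)
      finally show ?case by (simp add: ennreal_leI)
    qed
  qed
qed

lemma limsup_elog_sum_le: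
  assumes "finite A" "\<And>k. k \<in> A \<Longrightarrow> limsup (\<lambda>n. ereal (1 / real n) * elog (a k n)) \<le> C"
  shows "limsup (\<lambda>n. ereal (1 / real n) * elog (\<Sum>k\<in>A. a k n)) \<le> C"
  using assms
proof (induction A rule: finite_induct)
  case empty
  have "limsup (\<lambda>n. ereal (1 / real n) * elog (0::ennreal)) \<le> C"
    by (rule ereal_le_real, subst limsup_elog_le_iff) simp
  then show ?case by simp
next
  case (insert k A)
  then show ?case by (simp add: limsup_elog_add_le)
qed

lemma limsup_elog_exp_mult_le:
  assumes "limsup (\<lambda>n. ereal (1 / real n) * elog (a n)) \<le> ereal c"
  shows "limsup (\<lambda>n. ereal (1 / real n) * elog (ennreal (exp (real n * m)) * a n)) \<le> ereal (m + c)"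
  unfolding limsup_elog_le_iff
proof (intro allI impI)
  fix \<epsilon> :: real assume "\<epsilon> > 0"
  with assms have "\<forall>\<^sub>F n in sequentially. a n \<le> ennreal (exp (real n * (c + \<epsilon>)))"
    unfolding limsup_elog_le_iff by blast
  then show "\<forall>\<^sub>F n in sequentially. ennreal (exp (real n * m)) * a n \<le> ennreal (exp (real n * (m + c + \<epsilon>)))"
  proof eventually_elim
    case (elim n)
    have "ennreal (exp (real n * m)) * a n \<le> ennreal (exp (real n * m)) * ennreal (exp (real n * (c + \<epsilon>)))"
      by (intro mult_left_mono elim) auto
    then show ?case by (simp add: exp_add[symmetric] algebra_simps flip: ennreal_mult)
  qed
qed

section \<open>Exponential tightness\<close>

lemma space_borel_of [simp]: "space (borel_of T) = topspace T"
  by (simp add: borel_of_def space_measure_of_conv)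

lemma sets_borel_of: "sets (borel_of T) = sigma_sets (topspace T) {U. openin T U}"
  unfolding borel_of_def by (rule sets_measure_of) (auto dest: openin_subset)

lemma borel_of_open: "openin T U \<Longrightarrow> U \<in> sets (borel_of T)"
  by (auto simp: sets_borel_of)

lemma borel_of_closed:
  assumes "closedin T C" shows "C \<in> sets (borel_of T)"
proof -
  have "topspace T - (topspace T - C) \<in> sets (borel_of T)"
    using assms by (intro sets.Diff borel_of_open) (auto simp: closedin_def)
  moreover have "topspace T - (topspace T - C) = C" using closedin_subset[OF assms] by auto
  ultimately show ?thesis by simp
qed

text \<open>Applied below to the inclusion of the half-line into the reals, which makes integrands
  defined on all reals measurable for laws on \<open>borel_of nonneg_reals\<close>.\<close>

lemma borel_measurable_borel_of:
  fixes f :: "'x \<Rightarrow> 'y::topological_space"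
  assumes "continuous_map T euclidean f"
  shows "f \<in> borel_measurable (borel_of T)"
proof (rule borel_measurableI)
  fix S :: "'y set" assume "open S"
  then have "openin T {x \<in> topspace T. f x \<in> S}"
    using assms by (auto simp: continuous_map)
  moreover have "f -` S \<inter> space (borel_of T) = {x \<in> topspace T. f x \<in> S}" by auto
  ultimately show "f -` S \<inter> space (borel_of T) \<in> sets (borel_of T)"
    by (simp add: borel_of_open)
qed

text \<open>Letting \<open>a\<close> range over all reals is no stronger than large
  \<open>a\<close>, as a set for a larger \<open>a\<close> serves for a smaller one; it spares a
  sign condition in the full upper bound.\<close>

definition exponentially_tight :: "'x topology \<Rightarrow> (nat \<Rightarrow> 'x measure) \<Rightarrow> bool" where
  "exponentially_tight T \<nu> \<longleftrightarrow> (\<forall>a::real. \<exists>K. compactin T K \<and>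
     limsup (\<lambda>n. ereal (1 / real n) * elog (emeasure (\<nu> n) (topspace T - K))) \<le> ereal (- a))"

text \<open>Enclosing \<open>U\<close> in a compact closed set makes its closure compact, which is
  what the weak principle asks for.\<close>

lemma weak_ldp_lower:
  assumes "weak_ldp T \<nu> I" "openin T U" "compactin T K" "closedin T K" "U \<subseteq> K" "x \<in> U"
  shows "- I x \<le> liminf (\<lambda>n. ereal (1 / real n) * elog (emeasure (\<nu> n) U))"
proof -
  have "T closure_of U \<subseteq> K" using assms by (simp add: closure_of_minimal)
  then have "compactin T (T closure_of U)"
    using assms(3) closed_compactin closedin_closure_of by blast
  then have "- (INF y\<in>T interior_of U. I y) \<le> liminf (\<lambda>n. ereal (1 / real n) * elog (emeasure (\<nu> n) U))"
    using assms(1) borel_of_open[OF assms(2)] by (auto simp: weak_ldp_def ldp_bounds_def)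
  moreover have "(INF y\<in>T interior_of U. I y) \<le> I x"
    using assms(2,6) by (simp add: interior_of_openin INF_lower)
  ultimately show ?thesis by (meson ereal_minus_le_minus order_trans)
qed

lemma weak_ldp_upper:
  assumes "weak_ldp T \<nu> I" "compactin T K" "closedin T K"
  shows "limsup (\<lambda>n. ereal (1 / real n) * elog (emeasure (\<nu> n) K)) \<le> - (INF x\<in>K. I x)"
proof -
  have "T closure_of K = K" using assms(3) by (simp add: closure_of_closedin)
  then show ?thesis
    using assms(1,2) borel_of_closed[OF assms(3)] by (fastforce simp: weak_ldp_def ldp_bounds_def)
qed

text \<open>A point outside a compact \<open>K\<close> has a relatively compact neighbourhood
  missing \<open>K\<close>; the lower bound there makes I at least the decay rate of the complement.
  Sublevel sets are therefore closed subsets of compact sets.\<close>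

lemma proper_rate_if_exponentially_tight:
  assumes T: "locally_compact_space T" "Hausdorff_space T"
    and sets: "\<And>n. sets (\<nu> n) = sets (borel_of T)"
    and weak: "weak_ldp T \<nu> I" and tight: "exponentially_tight T \<nu>"
  shows "proper_rate T I"
  unfolding proper_rate_def
proof (intro allI impI)
  fix a :: real
  \<comment> \<open>Decay rate a + 1 rather than a, so that I x \<ge> a + 1 outside \<open>K\<close>
    contradicts I x \<le> a also in the case of equality.\<close>
  obtain K where K: "compactin T K"
    "limsup (\<lambda>n. ereal (1 / real n) * elog (emeasure (\<nu> n) (topspace T - K))) \<le> ereal (- (a + 1))"
    using tight unfolding exponentially_tight_def by blast
  have clK: "closedin T K" using K(1) T(2) compactin_imp_closedin by blast
  have "{x \<in> topspace T. I x \<le> ereal a} \<subseteq> K"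
  proof (clarify, rule ccontr)
    fix x assume x: "x \<in> topspace T" "I x \<le> ereal a" "x \<notin> K"
    obtain U C where U: "openin T U" "compactin T C" "x \<in> U" "U \<subseteq> C"
      using T(1) x(1) unfolding locally_compact_space_def by blast
    have "- I x \<le> liminf (\<lambda>n. ereal (1 / real n) * elog (emeasure (\<nu> n) (U - K)))"
      using U clK x T(2) by (intro weak_ldp_lower[OF weak _ U(2)]) (auto simp: compactin_imp_closedin)
    also have "\<dots> \<le> liminf (\<lambda>n. ereal (1 / real n) * elog (emeasure (\<nu> n) (topspace T - K)))"
      using U openin_subset[OF U(1)] clK
      by (intro liminf_elog_mono always_eventually allI emeasure_mono)
        (auto simp: sets intro!: borel_of_open)
    also have "\<dots> \<le> limsup (\<lambda>n. ereal (1 / real n) * elog (emeasure (\<nu> n) (topspace T - K)))"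
      by (intro Liminf_le_Limsup) auto
    also note K(2)
    finally have "- ereal (- (a + 1)) \<le> I x"
      by (subst ereal_uminus_le_reorder)
    then have "ereal (a + 1) \<le> I x" by (simp add: add.commute)
    then have "ereal (a + 1) \<le> ereal a" using x(2) by (rule order_trans)
    then show False by simp
  qed
  moreover have "closedin T {x \<in> topspace T. I x \<le> ereal a}"
    using weak by (auto simp: weak_ldp_def rate_function_def)
  ultimately show "compactin T {x \<in> topspace T. I x \<le> ereal a}"
    using K(1) closed_compactin by blast
qed

text \<open>The lower bound is local, so local compactness reduces it to the weak principle. For the
  upper bound the set is split along a compact \<open>K\<close> whose complement is exponentially
  negligible.\<close>

lemma full_ldp_if_exponentially_tight:
  assumes T: "locally_compact_space T" "Hausdorff_space T"
    and sets: "\<And>n. sets (\<nu> n) = sets (borel_of T)"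
    and weak: "weak_ldp T \<nu> I" and tight: "exponentially_tight T \<nu>"
  shows "full_ldp T \<nu> I"
  unfolding full_ldp_def
proof (intro conjI ballI)
  show "rate_function T I" using weak by (simp add: weak_ldp_def)
  fix \<Lambda> assume \<Lambda>: "\<Lambda> \<in> sets (borel_of T)"
  have \<Lambda>sub: "\<Lambda> \<subseteq> topspace T" using sets.sets_into_space[OF \<Lambda>] by simp
  show "ldp_bounds T \<nu> I \<Lambda>"
    unfolding ldp_bounds_def
  proof
    have "- liminf (\<lambda>n. ereal (1 / real n) * elog (emeasure (\<nu> n) \<Lambda>)) \<le> I x"
      if x: "x \<in> T interior_of \<Lambda>" for x
    proof -
      have "x \<in> topspace T" using x interior_of_subset_topspace[of T \<Lambda>] by blast
      then obtain U C where U: "openin T U" "compactin T C" "x \<in> U" "U \<subseteq> C"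
        using T(1) unfolding locally_compact_space_def by blast
      have "- I x \<le> liminf (\<lambda>n. ereal (1 / real n) * elog (emeasure (\<nu> n) (U \<inter> T interior_of \<Lambda>)))"
        using U x T(2) by (intro weak_ldp_lower[OF weak _ U(2)]) (auto simp: compactin_imp_closedin)
      also have "\<dots> \<le> liminf (\<lambda>n. ereal (1 / real n) * elog (emeasure (\<nu> n) \<Lambda>))"
        using interior_of_subset[of T \<Lambda>] \<Lambda>
        by (intro liminf_elog_mono always_eventually allI emeasure_mono) (auto simp: sets)
      finally show ?thesis using ereal_uminus_le_reorder by blast
    qed
    then have "- liminf (\<lambda>n. ereal (1 / real n) * elog (emeasure (\<nu> n) \<Lambda>)) \<le> (INF x\<in>T interior_of \<Lambda>. I x)"
      by (rule INF_greatest)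
    then show "- (INF x\<in>T interior_of \<Lambda>. I x) \<le> liminf (\<lambda>n. ereal (1 / real n) * elog (emeasure (\<nu> n) \<Lambda>))"
      using ereal_uminus_le_reorder by blast
  next
    show "limsup (\<lambda>n. ereal (1 / real n) * elog (emeasure (\<nu> n) \<Lambda>)) \<le> - (INF x\<in>T closure_of \<Lambda>. I x)"
    proof (rule ereal_le_real)
      \<comment> \<open>A real level \<open>z\<close> is used because the right-hand side may be
        -\<infinity>; \<open>K\<close> then depends on \<open>z\<close>.\<close>
      fix z assume z: "- (INF x\<in>T closure_of \<Lambda>. I x) \<le> ereal z"
      obtain K where K: "compactin T K"
        "limsup (\<lambda>n. ereal (1 / real n) * elog (emeasure (\<nu> n) (topspace T - K))) \<le> ereal z"
        using tight[unfolded exponentially_tight_def, rule_format, of "- z"] by auto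
      have clK: "closedin T K" using K(1) T(2) compactin_imp_closedin by blast
      let ?C = "T closure_of \<Lambda> \<inter> K"
      have "limsup (\<lambda>n. ereal (1 / real n) * elog (emeasure (\<nu> n) ?C)) \<le> - (INF x\<in>?C. I x)"
        using clK by (intro weak_ldp_upper[OF weak] closedin_Int closedin_closure_of closed_compactin[OF K(1)]) auto
      also have "\<dots> \<le> - (INF x\<in>T closure_of \<Lambda>. I x)"
        by (simp add: INF_superset_mono)
      also note z
      finally have le: "limsup (\<lambda>n. ereal (1 / real n) *
          elog (emeasure (\<nu> n) ?C + emeasure (\<nu> n) (topspace T - K))) \<le> ereal z"
        using K(2) by (rule limsup_elog_add_le)
      have "emeasure (\<nu> n) \<Lambda> \<le> emeasure (\<nu> n) ?C + emeasure (\<nu> n) (topspace T - K)" for n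
      proof -
        have m: "?C \<in> sets (\<nu> n)" "topspace T - K \<in> sets (\<nu> n)"
          using clK unfolding sets
          by (simp_all add: borel_of_closed borel_of_open closedin_Int openin_diff)
        have "emeasure (\<nu> n) \<Lambda> \<le> emeasure (\<nu> n) (?C \<union> (topspace T - K))"
          using \<Lambda>sub closure_of_subset[OF \<Lambda>sub] m by (intro emeasure_mono) auto
        also have "\<dots> \<le> emeasure (\<nu> n) ?C + emeasure (\<nu> n) (topspace T - K)"
          using m by (rule emeasure_subadditive)
        finally show ?thesis .
      qed
      then show "limsup (\<lambda>n. ereal (1 / real n) * elog (emeasure (\<nu> n) \<Lambda>)) \<le> ereal z"
        by (intro order_trans[OF limsup_elog_mono le] always_eventually allI)
    qed
  qed
qed

section \<open>Fenchel-Legendre duality\<close>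

text \<open>The epigraph of I is closed by lower semicontinuity and convex by convexity, so a
  hyperplane separates it strictly from the point (x, a) below the graph. A non-vertical hyperplane
  is the graph of the wanted line.\<close>

lemma supporting_line:
  fixes I :: "real \<Rightarrow> ereal"
  assumes rate: "rate_function nonneg_reals I" and conv: "convex_rate I"
    and x: "x \<ge> 0" and a: "ereal a < I x"
  obtains t where "\<And>y. y \<ge> 0 \<Longrightarrow> ereal (a + t * (y - x)) \<le> I y"
proof -
  have nn: "0 \<le> I y" if "y \<ge> 0" for y using rate that by (auto simp: rate_function_def)
  have sub: "closed {y\<in>{0..}. I y \<le> ereal r}" for r
    using rate by (intro closedin_closed_trans[OF _ closed_atLeast[of 0]]) (simp add: rate_function_def)
  define E where "E = {(y, r). y \<ge> 0 \<and> I y \<le> ereal r}"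
  have "closed E"
    unfolding closed_sequential_limits
  proof safe
    fix p and y r :: real assume p: "\<forall>n. p n \<in> E" "p \<longlonglongrightarrow> (y, r)"
    have lim: "(\<lambda>n. fst (p n)) \<longlonglongrightarrow> y" "(\<lambda>n. snd (p n)) \<longlonglongrightarrow> r"
      using tendsto_fst[OF p(2)] tendsto_snd[OF p(2)] by auto
    \<comment> \<open>The levels \<open>snd (p n)\<close> vary, whereas lower semicontinuity
      concerns one sublevel set at a time; the room \<open>e\<close> puts almost all
      \<open>fst (p n)\<close> into a single one.\<close>
    have *: "y \<ge> 0 \<and> I y \<le> ereal (r + e)" if "e > 0" for e
    proof -
      have "\<forall>\<^sub>F n in sequentially. snd (p n) < r + e"
        using lim(2) that by (simp add: order_tendstoD)
      then have "\<forall>\<^sub>F n in sequentially. fst (p n) \<in> {y\<in>{0..}. I y \<le> ereal (r + e)}"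
      proof eventually_elim
        case (elim n)
        have "fst (p n) \<ge> 0" "I (fst (p n)) \<le> ereal (snd (p n))"
          using p(1)[rule_format, of n] by (auto simp: E_def split_beta)
        moreover have "ereal (snd (p n)) \<le> ereal (r + e)" using elim by simp
        ultimately show ?case using order_trans[of "I (fst (p n))"] by simp
      qed
      then have "y \<in> {y\<in>{0..}. I y \<le> ereal (r + e)}"
        by (rule Lim_in_closed_set[OF sub _ trivial_limit_sequentially lim(1)])
      then show ?thesis by simp
    qed
    have "I y \<le> ereal r" by (rule ereal_le_epsilon2) (simp add: *)
    then show "(y, r) \<in> E" using *[of 1] by (simp add: E_def)
  qed
  moreover have "convex E"
    unfolding convex_alt
  proof safe
    fix y r y' r' s :: real
    assume H: "(y, r) \<in> E" "(y', r') \<in> E" "0 \<le> s" "s \<le> 1"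
    then have nn: "y \<ge> 0" "y' \<ge> 0" and le: "I y \<le> ereal r" "I y' \<le> ereal r'"
      by (auto simp: E_def)
    have "I ((1 - s) * y + s * y') \<le> ereal (1 - s) * I y + ereal s * I y'"
      using H(3,4) by (intro conv[unfolded convex_rate_def, rule_format] nn) simp
    also have "\<dots> \<le> ereal (1 - s) * ereal r + ereal s * ereal r'"
      using H(3,4) by (intro add_mono ereal_mult_left_mono le) simp_all
    finally have "I ((1 - s) * y + s * y') \<le> ereal ((1 - s) * r + s * r')" by simp
    moreover have "(1 - s) * y + s * y' \<ge> 0" using nn H(3,4) by simp
    ultimately show "(1 - s) *\<^sub>R (y, r) + s *\<^sub>R (y', r') \<in> E"
      unfolding E_def scaleR_Pair add_Pair by simp
  qed
  moreover have "(x, a) \<notin> E" using a by (auto simp: E_def)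
  ultimately obtain w b where w: "inner w (x, a) < b" "\<forall>p\<in>E. inner w p > b"
    using separating_hyperplane_closed_point by blast
  obtain u v where uv: "w = (u, v)" by (cases w)
  have above: "u * y + v * r > b" if "y \<ge> 0" "I y \<le> ereal r" for y r
    using w(2) that uv by (auto simp: E_def)
  have below: "u * x + v * a < b" using w(1) uv by simp
  show ?thesis
  proof (cases "\<exists>y\<ge>0. I y < \<infinity>")
    \<comment> \<open>The epigraph is empty, so the separation carries no information, but any line
      lies below I.\<close>
    case False
    then have "I y = \<infinity>" if "y \<ge> 0" for y using that by (auto simp: not_less)
    then show ?thesis by (intro that[of 0]) simp
  next
    case True
    then obtain y0 where "y0 \<ge> 0" "I y0 < \<infinity>" by blast
    moreover from this obtain r0 where "I y0 = ereal r0" using nn[of y0] by (cases "I y0") auto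
    ultimately have y0: "y0 \<ge> 0" "I y0 = ereal r0" by auto
    have "v \<ge> 0"
    proof (rule ccontr)
      assume "\<not> v \<ge> 0"
      then have v: "v < 0" by simp
      \<comment> \<open>The epigraph contains the whole vertical ray above (y0, r0). A negative
        \<open>v\<close> would push the functional below \<open>b\<close> along it, and this height
        is where that has happened.\<close>
      define r where "r = max r0 ((b - u * y0) / v)"
      have "(b - u * y0) / v \<le> r" by (simp add: r_def)
      then have "v * r \<le> b - u * y0" using v by (simp add: divide_le_eq mult.commute)
      moreover have "u * y0 + v * r > b" using y0 by (intro above) (auto simp: r_def)
      ultimately show False by simp
    qed
    show ?thesis
    proof (cases "v = 0")
      case False
      with \<open>v \<ge> 0\<close> have v: "v > 0" by simp
      show ?thesis
      \<comment> \<open>The slope results from solving u y + v r > u x + v a for r.\<close>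
      proof (rule that[of "- u / v"])
        fix y :: real assume y: "y \<ge> 0"
        show "ereal (a + - u / v * (y - x)) \<le> I y"
        proof (cases "I y")
          case (real r)
          then have "u * x + v * a < u * y + v * r" using above[OF y, of r] below by simp
          then have "a + - u / v * (y - x) \<le> r" using v by (simp add: field_simps)
          then show ?thesis using real by simp
        qed (use nn[OF y] in auto)
      qed
    next
      \<comment> \<open>A vertical separating line only says that \<open>I x = \<infinity>\<close>; tilting it about the
        nonnegative domain of \<open>I\<close> works because \<open>I \<ge> 0\<close>.\<close>
      case True
      \<comment> \<open>The bound K (b - u x) \<ge> a puts the tilted line below K (b - u y), which
        is at most 0 wherever I is finite, since u y > b there and K \<ge> 0.\<close>
      define K where "K = max 0 (a / (b - u * x))"
      have bx: "b - u * x > 0" using below True by simp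
      have "a / (b - u * x) \<le> K" by (simp add: K_def)
      then have Ka: "a \<le> K * (b - u * x)" using bx by (simp add: pos_divide_le_eq)
      show ?thesis
      proof (rule that[of "- K * u"])
        fix y :: real assume y: "y \<ge> 0"
        show "ereal (a + - K * u * (y - x)) \<le> I y"
        proof (cases "I y")
          case (real r)
          then have "b < u * y" using above[OF y, of r] True by simp
          then have "K * (b - u * y) \<le> 0" by (simp add: K_def mult_nonneg_nonpos)
          then have "a + - K * u * (y - x) \<le> 0" using Ka by (simp add: algebra_simps)
          then have "ereal (a + - K * u * (y - x)) \<le> 0" by (simp only: ereal_less_eq)
          then show ?thesis using nn[OF y] by (rule order_trans)
        qed (use nn[OF y] in auto)
      qed
    qed
  qed
qed

section \<open>Exponential integrals on the half-line\<close>

lemma closedin_nonneg_Icc [simp]: "0 \<le> a \<Longrightarrow> closedin nonneg_reals {a..b::real}"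
  by (rule closed_subset) auto

lemma compactin_nonneg_Icc [simp]: "0 \<le> a \<Longrightarrow> compactin nonneg_reals {a..b::real}"
  by (auto simp: compactin_subtopology)

lemma openin_nonneg_ball: "openin nonneg_reals ({x - r<..<x + r} \<inter> {0::real..})"
  by (auto simp: openin_open)

text \<open>Exponential Chebyshev on a small interval around x: there exp(n t y) is at least exp(n
  (t x - \<epsilon>)), while by the lower bound the interval has mass of rate at most I x.\<close>

lemma legendre_le_rate:
  fixes I :: "real \<Rightarrow> ereal"
  assumes sets: "\<And>n. sets (\<nu> n) = sets (borel_of nonneg_reals)"
    and weak: "weak_ldp nonneg_reals \<nu> I" and x: "x \<ge> 0"
  shows "ereal (t * x) - limsup (\<lambda>n. ereal (1 / real n) *
           elog (\<integral>\<^sup>+ y. ennreal (exp (real n * (t * y))) \<partial>\<nu> n)) \<le> I x"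
proof -
  let ?\<Lambda> = "limsup (\<lambda>n. ereal (1 / real n) *
           elog (\<integral>\<^sup>+ y. ennreal (exp (real n * (t * y))) \<partial>\<nu> n))"
  have le: "ereal (t * x - c) \<le> I x" if c: "?\<Lambda> \<le> ereal c" for c
  proof -
    have "- I x \<le> ereal (c - t * x) + ereal \<epsilon>" if "\<epsilon> > 0" for \<epsilon>
    proof -
      \<comment> \<open>Moving y by less than \<delta> changes t y by at most \<epsilon>; the
        summand 1 covers t = 0.\<close>
      define \<delta> where "\<delta> = \<epsilon> / (\<bar>t\<bar> + 1)"
      have \<delta>: "\<delta> > 0" "\<bar>t\<bar> * \<delta> \<le> \<epsilon>"
        using that by (auto simp: \<delta>_def field_simps)
      let ?U = "{x - \<delta><..<x + \<delta>} \<inter> {0..}"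
      let ?m = "t * x - \<epsilon>"
      have U: "?U \<in> sets (\<nu> n)" for n
        unfolding sets by (intro borel_of_open openin_nonneg_ball)
      have "- I x \<le> liminf (\<lambda>n. ereal (1 / real n) * elog (emeasure (\<nu> n) ?U))"
        using \<delta>(1) x by (intro weak_ldp_lower[OF weak openin_nonneg_ball, of "{0..x + \<delta>}"]) auto
      also have "\<dots> \<le> limsup (\<lambda>n. ereal (1 / real n) * elog (emeasure (\<nu> n) ?U))"
        by (intro Liminf_le_Limsup) auto
      also have "\<dots> \<le> limsup (\<lambda>n. ereal (1 / real n) * elog (ennreal (exp (real n * - ?m)) *
          (\<integral>\<^sup>+ y. ennreal (exp (real n * (t * y))) \<partial>\<nu> n)))"
      proof (intro limsup_elog_mono always_eventually allI)
        fix n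
        have id: "(\<lambda>y. y) \<in> borel_measurable (\<nu> n)"
          unfolding measurable_cong_sets[OF sets refl] by (rule borel_measurable_borel_of) simp
        have meas: "(\<lambda>y. ennreal (exp (real n * (t * y)))) \<in> borel_measurable (\<nu> n)"
          by (rule measurable_compose[OF id]) simp
        have "emeasure (\<nu> n) ?U = (\<integral>\<^sup>+ y. indicator ?U y \<partial>\<nu> n)" using U by simp
        also have "\<dots> \<le> (\<integral>\<^sup>+ y. ennreal (exp (real n * - ?m)) * ennreal (exp (real n * (t * y))) \<partial>\<nu> n)"
        proof (rule nn_integral_mono)
          fix y
          have "1 \<le> exp (real n * (t * y - ?m))" if "y \<in> ?U"
          proof -
            have "\<bar>t * (x - y)\<bar> \<le> \<bar>t\<bar> * \<delta>"
              using that unfolding abs_mult by (intro mult_left_mono) auto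
            then have "t * x - t * y \<le> \<epsilon>" using \<delta>(2) by (simp add: algebra_simps)
            then show ?thesis by simp
          qed
          moreover have "ennreal (exp (real n * - ?m)) * ennreal (exp (real n * (t * y))) =
              ennreal (exp (real n * (t * y - ?m)))"
            by (simp add: exp_add[symmetric] right_diff_distrib flip: ennreal_mult)
          ultimately show "indicator ?U y \<le> ennreal (exp (real n * - ?m)) * ennreal (exp (real n * (t * y)))"
            by (simp only: indicator_def) simp
        qed
        also have "\<dots> = ennreal (exp (real n * - ?m)) * (\<integral>\<^sup>+ y. ennreal (exp (real n * (t * y))) \<partial>\<nu> n)"
          by (rule nn_integral_cmult[OF meas])
        finally show "emeasure (\<nu> n) ?U \<le> \<dots>" .
      qed
      also have "\<dots> \<le> ereal (- ?m + c)" by (rule limsup_elog_exp_mult_le[OF c])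
      finally show ?thesis by (simp add: algebra_simps)
    qed
    then have "- I x \<le> ereal (c - t * x)" by (rule ereal_le_epsilon2)
    then have "- ereal (c - t * x) \<le> I x" using ereal_uminus_le_reorder by blast
    then show ?thesis by simp
  qed
  show ?thesis
  proof (cases ?\<Lambda>)
    case (real c)
    then show ?thesis using le[of c] by simp
  next
    case MInf
    have "ereal z \<le> I x" for z using le[of "t * x - z"] MInf by simp
    then have "I x = \<infinity>" using ereal_top by blast
    then show ?thesis by simp
  qed simp
qed

text \<open>The upper bound in Varadhan's lemma, for an affine minorant of the rate function: cut
  \<open>[0, R]\<close> into short intervals, on each of which the exponential is nearly constant.\<close>

lemma log_mgf_le:
  fixes I :: "real \<Rightarrow> ereal"
  assumes sets: "\<And>n. sets (\<nu> n) = sets (borel_of nonneg_reals)"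
    and weak: "weak_ldp nonneg_reals \<nu> I"
    and minorant: "\<And>y. y \<ge> 0 \<Longrightarrow> ereal (t * y - c) \<le> I y"
    and tail: "limsup (\<lambda>n. ereal (1 / real n) *
           elog (\<integral>\<^sup>+ y. ennreal (exp (real n * (t * y))) * indicator {R<..} y \<partial>\<nu> n)) \<le> ereal c"
  shows "limsup (\<lambda>n. ereal (1 / real n) *
           elog (\<integral>\<^sup>+ y. ennreal (exp (real n * (t * y))) \<partial>\<nu> n)) \<le> ereal c"
proof (rule ereal_le_epsilon2)
  fix \<epsilon> :: real assume \<epsilon>: "\<epsilon> > 0"
  \<comment> \<open>The error \<bar>t\<bar> \<delta> occurs twice on each interval: in replacing the
    exponent t y by \<open>m k\<close>, and in bounding the minorant of I from below.\<close>
  define \<delta> where "\<delta> = \<epsilon> / (2 * (\<bar>t\<bar> + 1))"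
  have \<delta>: "\<delta> > 0" "2 * (\<bar>t\<bar> * \<delta>) \<le> \<epsilon>"
    using \<epsilon> by (auto simp: \<delta>_def field_simps)
  obtain N :: nat where N: "R < real N * \<delta>"
    using reals_Archimedean3[OF \<delta>(1)] by blast
  \<comment> \<open>Closed intervals, since the weak upper bound is applied to compact sets. Shared
    end points are counted twice, which is harmless in an upper estimate.\<close>
  define J where "J k = {real k * \<delta>..(real k + 1) * \<delta>}" for k :: nat
  define m where "m k = t * (real k * \<delta>) + \<bar>t\<bar> * \<delta>" for k :: nat
  let ?f = "\<lambda>n y. ennreal (exp (real n * (t * y)))"
  have cl: "closedin nonneg_reals (J k)" "compactin nonneg_reals (J k)" for k
    using \<delta>(1) by (auto simp: J_def)
  have near: "\<bar>t * (y - real k * \<delta>)\<bar> \<le> \<bar>t\<bar> * \<delta>" if "y \<in> J k" for y k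
    using that unfolding abs_mult by (intro mult_left_mono) (auto simp: J_def algebra_simps)
  have piece: "limsup (\<lambda>n. ereal (1 / real n) *
      elog (ennreal (exp (real n * m k)) * emeasure (\<nu> n) (J k))) \<le> ereal (c + \<epsilon>)" for k
  proof -
    have "ereal (t * (real k * \<delta>) - \<bar>t\<bar> * \<delta> - c) \<le> (INF y\<in>J k. I y)"
    proof (rule INF_greatest)
      fix y assume y: "y \<in> J k"
      have "0 \<le> real k * \<delta>" using \<delta>(1) by simp
      then have "y \<ge> 0" using y by (auto simp: J_def)
      have "t * (real k * \<delta>) - \<bar>t\<bar> * \<delta> - c \<le> t * y - c"
        using near[OF y] by (simp add: algebra_simps)
      then show "ereal (t * (real k * \<delta>) - \<bar>t\<bar> * \<delta> - c) \<le> I y"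
        using minorant[OF \<open>y \<ge> 0\<close>] by (meson ereal_less_eq(3) order_trans)
    qed
    then have "- (INF y\<in>J k. I y) \<le> ereal (c + \<bar>t\<bar> * \<delta> - t * (real k * \<delta>))"
      using ereal_uminus_le_reorder by (fastforce simp: algebra_simps)
    with weak_ldp_upper[OF weak cl(2,1)] have
      "limsup (\<lambda>n. ereal (1 / real n) * elog (emeasure (\<nu> n) (J k))) \<le>
        ereal (c + \<bar>t\<bar> * \<delta> - t * (real k * \<delta>))"
      by (rule order_trans)
    from limsup_elog_exp_mult_le[OF this, of "m k"] show ?thesis
      by (rule order_trans) (use \<delta>(2) in \<open>simp add: m_def mult.commute\<close>)
  qed
  have "(\<integral>\<^sup>+ y. ?f n y \<partial>\<nu> n) \<le> (\<Sum>k<N. ennreal (exp (real n * m k)) * emeasure (\<nu> n) (J k)) +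
      (\<integral>\<^sup>+ y. ?f n y * indicator {R<..} y \<partial>\<nu> n)" for n
  proof -
    have id: "(\<lambda>y. y) \<in> borel_measurable (\<nu> n)"
      unfolding measurable_cong_sets[OF sets refl] by (rule borel_measurable_borel_of) simp
    have J: "J k \<in> sets (\<nu> n)" for k unfolding sets by (intro borel_of_closed cl)
    have g: "(\<lambda>y. \<Sum>k<N. ennreal (exp (real n * m k)) * indicator (J k) y) \<in> borel_measurable (\<nu> n)"
      by (intro borel_measurable_sum borel_measurable_times_ennreal borel_measurable_const
          borel_measurable_indicator J)
    have h: "(\<lambda>y. ?f n y * indicator {R<..} y) \<in> borel_measurable (\<nu> n)"
      by (rule measurable_compose[OF id]) simp
    have "(\<integral>\<^sup>+ y. ?f n y \<partial>\<nu> n) \<le> (\<integral>\<^sup>+ y. (\<Sum>k<N. ennreal (exp (real n * m k)) * indicator (J k) y) +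
        ?f n y * indicator {R<..} y \<partial>\<nu> n)"
    proof (rule nn_integral_mono)
      fix y assume "y \<in> space (\<nu> n)"
      then have y: "y \<ge> 0" using sets_eq_imp_space_eq[OF sets] by auto
      show "?f n y \<le> (\<Sum>k<N. ennreal (exp (real n * m k)) * indicator (J k) y) +
        ?f n y * indicator {R<..} y"
      proof (cases "y > R")
        case True
        then show ?thesis by simp
      next
        case False
        define k where "k = nat \<lfloor>y / \<delta>\<rfloor>"
        have k: "real k = of_int \<lfloor>y / \<delta>\<rfloor>" using y \<delta>(1) by (simp add: k_def)
        have "real k \<le> y / \<delta>" "y / \<delta> < real k + 1" unfolding k by linarith+
        then have yk: "y \<in> J k" using \<delta>(1) by (auto simp: J_def field_simps)
        have "real k * \<delta> < real N * \<delta>" using yk False N by (simp add: J_def)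
        then have "k < N" using \<delta>(1) by simp
        have "t * y \<le> m k" using near[OF yk] by (simp add: m_def algebra_simps)
        then have "?f n y \<le> ennreal (exp (real n * m k)) * indicator (J k) y"
          using yk by (simp add: ennreal_leI mult_left_mono)
        also have "\<dots> \<le> (\<Sum>k<N. ennreal (exp (real n * m k)) * indicator (J k) y)"
          using \<open>k < N\<close> by (intro member_le_sum) auto
        finally show ?thesis by (simp add: add_increasing2)
      qed
    qed
    also have "\<dots> = (\<Sum>k<N. ennreal (exp (real n * m k)) * emeasure (\<nu> n) (J k)) +
        (\<integral>\<^sup>+ y. ?f n y * indicator {R<..} y \<partial>\<nu> n)"
      by (simp only: nn_integral_add[OF g h])
        (subst nn_integral_sum, intro borel_measurable_times_ennreal borel_measurable_const
          borel_measurable_indicator J, simp only: nn_integral_cmult_indicator J)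
    finally show ?thesis .
  qed
  then have "limsup (\<lambda>n. ereal (1 / real n) * elog (\<integral>\<^sup>+ y. ?f n y \<partial>\<nu> n)) \<le>
    limsup (\<lambda>n. ereal (1 / real n) * elog ((\<Sum>k<N. ennreal (exp (real n * m k)) * emeasure (\<nu> n) (J k)) +
      (\<integral>\<^sup>+ y. ?f n y * indicator {R<..} y \<partial>\<nu> n)))"
    by (intro limsup_elog_mono always_eventually) auto
  also have "\<dots> \<le> ereal (c + \<epsilon>)"
    using tail \<epsilon> by (intro limsup_elog_add_le limsup_elog_sum_le piece) (auto elim: order_trans)
  finally show "limsup (\<lambda>n. ereal (1 / real n) * elog (\<integral>\<^sup>+ y. ?f n y \<partial>\<nu> n)) \<le> ereal c + ereal \<epsilon>"
    by simp
qed

text \<open>Each real a < I x is a value at x of an affine minorant of I, and the slope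
  \<open>t\<close> of that minorant makes the expression under the supremum at least a.\<close>

lemma rate_eq_legendre:
  fixes I :: "real \<Rightarrow> ereal"
  assumes sets: "\<And>n. sets (\<nu> n) = sets (borel_of nonneg_reals)"
    and weak: "weak_ldp nonneg_reals \<nu> I" and conv: "convex_rate I"
    and tail: "\<And>t c. \<exists>R. limsup (\<lambda>n. ereal (1 / real n) *
           elog (\<integral>\<^sup>+ y. ennreal (exp (real n * (t * y))) * indicator {R<..} y \<partial>\<nu> n)) \<le> ereal c"
    and x: "x \<ge> 0"
  shows "I x = (SUP t. ereal (t * x) - limsup (\<lambda>n. ereal (1 / real n) *
           elog (\<integral>\<^sup>+ y. ennreal (exp (real n * (t * y))) \<partial>\<nu> n)))"
    (is "_ = (SUP t. ?F t)")
proof (rule antisym)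
  show "(SUP t. ?F t) \<le> I x"
    by (intro SUP_least legendre_le_rate[OF sets weak x])
  show "I x \<le> (SUP t. ?F t)"
  \<comment> \<open>Approaching I x from below also covers I x = \<infinity>, where no line can
    touch the graph.\<close>
  proof (rule dense_le)
    fix z assume z: "z < I x"
    show "z \<le> (SUP t. ?F t)"
    proof (cases z)
      case (real a)
      have rate: "rate_function nonneg_reals I" using weak by (simp add: weak_ldp_def)
      obtain t where t: "\<And>y. y \<ge> 0 \<Longrightarrow> ereal (a + t * (y - x)) \<le> I y"
        using supporting_line[OF rate conv x] z real by blast
      obtain R where R: "limsup (\<lambda>n. ereal (1 / real n) *
           elog (\<integral>\<^sup>+ y. ennreal (exp (real n * (t * y))) * indicator {R<..} y \<partial>\<nu> n)) \<le> ereal (t * x - a)"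
        using tail by blast
      have "limsup (\<lambda>n. ereal (1 / real n) *
           elog (\<integral>\<^sup>+ y. ennreal (exp (real n * (t * y))) \<partial>\<nu> n)) \<le> ereal (t * x - a)"
        using t by (intro log_mgf_le[OF sets weak _ R]) (auto simp: algebra_simps)
      then have "ereal (t * x) - ereal (t * x - a) \<le> ?F t"
        by (intro ereal_minus_mono) auto
      also have "\<dots> \<le> (SUP t. ?F t)" by (rule SUP_upper) simp
      finally show ?thesis using real by simp
    qed (use z in auto)
  qed
qed

text \<open>For y > R one has exp(n t y) \<le> exp(-n (u - t) R) exp(n u y), so the surplus u - t in
  the order of the moment buys any rate by enlarging R.\<close>

lemma exp_moment_tail:
  assumes sets: "\<And>n. sets (\<nu> n) = sets (borel_of nonneg_reals)"
    and moment: "\<And>n. n \<ge> 1 \<Longrightarrow>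
      (\<integral>\<^sup>+ y. ennreal (exp (real n * (u * y))) \<partial>\<nu> n) \<le> ennreal (exp (real n * b))"
    and tu: "t < u"
  shows "\<exists>R. limsup (\<lambda>n. ereal (1 / real n) *
           elog (\<integral>\<^sup>+ y. ennreal (exp (real n * (t * y))) * indicator {R<..} y \<partial>\<nu> n)) \<le> ereal c"
proof -
  \<comment> \<open>The solution of b - (u - t) R = c. It may be negative, in which case the tail is
    the whole half-line.\<close>
  define R where "R = (b - c) / (u - t)"
  have R: "b - (u - t) * R = c" using tu by (simp add: R_def)
  have "(\<integral>\<^sup>+ y. ennreal (exp (real n * (t * y))) * indicator {R<..} y \<partial>\<nu> n) \<le> ennreal (exp (real n * c))"
    if n: "n \<ge> 1" for n
  proof -
    have id: "(\<lambda>y. y) \<in> borel_measurable (\<nu> n)"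
      unfolding measurable_cong_sets[OF sets refl] by (rule borel_measurable_borel_of) simp
    have meas: "(\<lambda>y. ennreal (exp (real n * (u * y)))) \<in> borel_measurable (\<nu> n)"
      by (rule measurable_compose[OF id]) simp
    have "(\<integral>\<^sup>+ y. ennreal (exp (real n * (t * y))) * indicator {R<..} y \<partial>\<nu> n) \<le>
      (\<integral>\<^sup>+ y. ennreal (exp (real n * - ((u - t) * R))) * ennreal (exp (real n * (u * y))) \<partial>\<nu> n)"
    proof (rule nn_integral_mono)
      fix y
      have "real n * (t * y) \<le> real n * - ((u - t) * R) + real n * (u * y)" if "y > R"
      proof -
        have "0 \<le> real n * ((u - t) * (y - R))" using that tu by simp
        then show ?thesis by (simp add: algebra_simps)
      qed
      then show "ennreal (exp (real n * (t * y))) * indicator {R<..} y \<le>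
        ennreal (exp (real n * - ((u - t) * R))) * ennreal (exp (real n * (u * y)))"
        by (auto simp: indicator_def exp_add[symmetric] simp flip: ennreal_mult intro!: ennreal_leI)
    qed
    also have "\<dots> = ennreal (exp (real n * - ((u - t) * R))) * (\<integral>\<^sup>+ y. ennreal (exp (real n * (u * y))) \<partial>\<nu> n)"
      by (rule nn_integral_cmult[OF meas])
    also have "\<dots> \<le> ennreal (exp (real n * - ((u - t) * R))) * ennreal (exp (real n * b))"
      by (intro mult_left_mono moment n) auto
    also have "\<dots> = ennreal (exp (real n * c))"
      by (simp add: R[symmetric] exp_add[symmetric] right_diff_distrib flip: ennreal_mult)
    finally show ?thesis .
  qed
  then have "\<forall>\<^sub>F n in sequentially. ereal (1 / real n) *
      elog (\<integral>\<^sup>+ y. ennreal (exp (real n * (t * y))) * indicator {R<..} y \<partial>\<nu> n) \<le> ereal c"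
    by (intro eventually_mono[OF eventually_ge_at_top[of 1]]) (simp add: scaled_elog_le_iff)
  then show ?thesis by (blast intro: Limsup_bounded)
qed

text \<open>This is the tail bound at t = 0, where the integrand reduces to the indicator of y > R
  and the compact set is [0, R].\<close>

lemma exp_moment_exponentially_tight:
  assumes sets: "\<And>n. sets (\<nu> n) = sets (borel_of nonneg_reals)"
    and moment: "\<And>n. n \<ge> 1 \<Longrightarrow>
      (\<integral>\<^sup>+ y. ennreal (exp (real n * (u * y))) \<partial>\<nu> n) \<le> ennreal (exp (real n * b))"
    and u: "0 < u"
  shows "exponentially_tight nonneg_reals \<nu>"
  unfolding exponentially_tight_def
proof
  fix a :: real
  obtain R where R: "limsup (\<lambda>n. ereal (1 / real n) *
      elog (\<integral>\<^sup>+ y. ennreal (exp (real n * (0 * y))) * indicator {R<..} y \<partial>\<nu> n)) \<le> ereal (- a)"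
    using exp_moment_tail[OF sets moment u] by blast
  have "emeasure (\<nu> n) (topspace nonneg_reals - {0..R}) =
      (\<integral>\<^sup>+ y. ennreal (exp (real n * (0 * y))) * indicator {R<..} y \<partial>\<nu> n)" for n
  proof -
    have "topspace nonneg_reals - {0..R} \<in> sets (\<nu> n)"
      unfolding sets by (intro borel_of_open openin_diff openin_topspace closedin_nonneg_Icc order_refl)
    then have "emeasure (\<nu> n) (topspace nonneg_reals - {0..R}) =
        (\<integral>\<^sup>+ y. indicator (topspace nonneg_reals - {0..R}) y \<partial>\<nu> n)"
      by simp
    also have "\<dots> = (\<integral>\<^sup>+ y. indicator {R<..} y \<partial>\<nu> n)"
      using sets_eq_imp_space_eq[OF sets] by (intro nn_integral_cong) (auto simp: indicator_def)
    finally show ?thesis by simp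
  qed
  with R show "\<exists>K. compactin nonneg_reals K \<and> limsup (\<lambda>n. ereal (1 / real n) *
      elog (emeasure (\<nu> n) (topspace nonneg_reals - K))) \<le> ereal (- a)"
    by (intro exI[of _ "{0..R}"]) simp
qed

section \<open>Word length\<close>

lemma (in monoid) foldr_mult_closed:
  "set xs \<subseteq> carrier G \<Longrightarrow> foldr (\<otimes>) xs \<one> \<in> carrier G"
  by (induction xs) auto

lemma (in monoid) foldr_mult_append:
  "set xs \<subseteq> carrier G \<Longrightarrow> set ys \<subseteq> carrier G \<Longrightarrow>
     foldr (\<otimes>) (xs @ ys) \<one> = foldr (\<otimes>) xs \<one> \<otimes> foldr (\<otimes>) ys \<one>"
  by (induction xs) (auto simp: m_assoc foldr_mult_closed)

text \<open>Words give both the existence of a spelling for every element, on which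
  \<open>word_length\<close> depends, and the countability of a finitely generated group.\<close>

lemma (in group) generate_eq_words:
  assumes "S \<subseteq> carrier G"
  shows "generate G S = (\<lambda>xs. foldr (\<otimes>) xs \<one>) ` lists (S \<union> m_inv G ` S)"
proof
  let ?A = "S \<union> m_inv G ` S"
  have A: "?A \<subseteq> carrier G" using assms by auto
  show "generate G S \<subseteq> (\<lambda>xs. foldr (\<otimes>) xs \<one>) ` lists ?A"
  proof
    fix g assume "g \<in> generate G S"
    then show "g \<in> (\<lambda>xs. foldr (\<otimes>) xs \<one>) ` lists ?A"
    proof (induction rule: generate.induct)
      case one
      show ?case by (rule image_eqI[of _ _ "[]"]) auto
    next
      case (incl h)
      then show ?case using assms by (intro image_eqI[of _ _ "[h]"]) auto
    next
      case (inv h)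
      then show ?case using assms by (intro image_eqI[of _ _ "[inv h]"]) auto
    next
      case (eng g h)
      then obtain xs ys where "xs \<in> lists ?A" "g = foldr (\<otimes>) xs \<one>" "ys \<in> lists ?A" "h = foldr (\<otimes>) ys \<one>"
        by blast
      moreover from this have "set xs \<subseteq> carrier G" "set ys \<subseteq> carrier G" using A by auto
      ultimately show ?case
        using foldr_mult_append by (intro image_eqI[of _ _ "xs @ ys"]) auto
    qed
  qed
  have "foldr (\<otimes>) xs \<one> \<in> generate G S" if "xs \<in> lists ?A" for xs
    using that by (induction xs) (auto intro: generate.intros)
  then show "(\<lambda>xs. foldr (\<otimes>) xs \<one>) ` lists ?A \<subseteq> generate G S"
    by (rule image_subsetI)
qed

context group
begin

context
  fixes S \<H>
  assumes S: "S \<subseteq> carrier G" "generate G S = carrier G" and \<H>: "\<Union>\<H> \<subseteq> carrier G"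
begin

lemma word_length_le:
  assumes "set xs \<subseteq> S \<union> m_inv G ` S \<union> \<Union>\<H>"
  shows "word_length G S \<H> (foldr (\<otimes>) xs \<one>) \<le> length xs"
proof (cases "foldr (\<otimes>) xs \<one> = \<one>")
  case False
  then have "length xs \<ge> 1" by (cases xs) auto
  with False assms show ?thesis
    unfolding word_length_def by (auto intro!: cInf_lower)
qed (simp add: word_length_def)

lemma word_length_attained:
  assumes "g \<in> carrier G"
  obtains xs where "set xs \<subseteq> S \<union> m_inv G ` S \<union> \<Union>\<H>" "g = foldr (\<otimes>) xs \<one>"
    "length xs = word_length G S \<H> g"
proof (cases "g = \<one>")
  case True
  then show ?thesis by (intro that[of "[]"]) (auto simp: word_length_def)
next
  case False
  let ?W = "{n. n \<ge> 1 \<and> (\<exists>xs. length xs = n \<and> set xs \<subseteq> S \<union> m_inv G ` S \<union> \<Union>\<H> \<and> g = foldr (\<otimes>) xs \<one>)}"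
  \<comment> \<open>A word in \<open>S\<close> and its inverses already shows that the set of
    lengths is non-empty, so that \<open>Inf\<close> is a true minimum and not a default
    value.\<close>
  obtain xs where xs: "xs \<in> lists (S \<union> m_inv G ` S)" "g = foldr (\<otimes>) xs \<one>"
    using assms unfolding S(2)[symmetric] generate_eq_words[OF S(1)] by (rule imageE)
  with False have "length xs \<ge> 1" by (cases xs) auto
  moreover have "set xs \<subseteq> S \<union> m_inv G ` S \<union> \<Union>\<H>" using xs(1) by auto
  ultimately have "length xs \<in> ?W" using xs(2) by blast
  then have "Inf ?W \<in> ?W" by (intro Inf_nat_def1) blast
  moreover have "word_length G S \<H> g = Inf ?W" using False by (simp add: word_length_def)
  ultimately have "word_length G S \<H> g \<in> ?W" by simp
  then show ?thesis using that by blast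
qed

text \<open>Concatenate shortest words for the two factors.\<close>

lemma word_length_mult_le:
  assumes "g \<in> carrier G" "h \<in> carrier G"
  shows "word_length G S \<H> (g \<otimes> h) \<le> word_length G S \<H> g + word_length G S \<H> h"
proof -
  let ?A = "S \<union> m_inv G ` S \<union> \<Union>\<H>"
  have A: "?A \<subseteq> carrier G" using S \<H> by auto
  obtain xs where xs: "set xs \<subseteq> ?A" "g = foldr (\<otimes>) xs \<one>" "length xs = word_length G S \<H> g"
    using word_length_attained[OF assms(1)] .
  obtain ys where ys: "set ys \<subseteq> ?A" "h = foldr (\<otimes>) ys \<one>" "length ys = word_length G S \<H> h"
    using word_length_attained[OF assms(2)] .
  have "g \<otimes> h = foldr (\<otimes>) (xs @ ys) \<one>"
    unfolding xs(2) ys(2)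
    by (rule foldr_mult_append[symmetric]) (rule subset_trans[OF _ A], fact)+
  then show ?thesis using word_length_le[of "xs @ ys"] xs ys by simp
qed

end

end

text \<open>Countability of the group is what makes products of random elements measurable
  below.\<close>

lemma (in group) countable_generate:
  assumes "S \<subseteq> carrier G" "countable S"
  shows "countable (generate G S)"
  using assms by (simp add: generate_eq_words)

section \<open>Exponential moments of the random walk\<close>

context group
begin

context
  fixes \<mu> :: "'a pmf" and M :: "'w measure" and X :: "nat \<Rightarrow> 'w \<Rightarrow> 'a"
  assumes iid: "iid_increments G \<mu> M X" and countable: "countable (carrier G)"
begin

lemma increment_measurable: "i \<ge> 1 \<Longrightarrow> X i \<in> measurable M (count_space (carrier G))"
  using iid by (auto simp: iid_increments_def distributed_def)

text \<open>A countable carrier allows splitting by the value of the walk at time n; for each fixed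
  value, left translation of the next increment is measurable.\<close>

lemma random_walk_measurable: "random_walk G X n \<in> measurable M (count_space (carrier G))"
proof (induction n)
  case 0
  have "random_walk G X 0 = (\<lambda>\<omega>. \<one>)" by (rule ext) simp
  then show ?case by simp
next
  case (Suc n)
  have "random_walk G X (Suc n) = (\<lambda>\<omega>. random_walk G X n \<omega> \<otimes> X (Suc n) \<omega>)"
    by (rule ext) simp
  moreover have "(\<lambda>\<omega>. random_walk G X n \<omega> \<otimes> X (Suc n) \<omega>) \<in> measurable M (count_space (carrier G))"
  proof (rule measurable_compose_countable'[OF _ Suc countable])
    fix g assume "g \<in> carrier G"
    then show "(\<lambda>\<omega>. g \<otimes> X (Suc n) \<omega>) \<in> measurable M (count_space (carrier G))"
      by (intro measurable_compose[OF increment_measurable]) auto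
  qed
  ultimately show ?case by simp
qed

text \<open>The increment has its density on the carrier, whereas \<open>measure_pmf \<mu>\<close>
  lives on the whole type; outside the carrier \<open>pmf \<mu>\<close> vanishes.\<close>

lemma nn_integral_increment:
  assumes "set_pmf \<mu> \<subseteq> carrier G" "i \<ge> 1"
  shows "(\<integral>\<^sup>+ \<omega>. f (X i \<omega>) \<partial>M) = (\<integral>\<^sup>+ g. f g \<partial>measure_pmf \<mu>)"
proof -
  have "(\<integral>\<^sup>+ \<omega>. f (X i \<omega>) \<partial>M) = (\<integral>\<^sup>+ g. ennreal (pmf \<mu> g) * f g \<partial>count_space (carrier G))"
    using iid assms(2) by (subst distributed_nn_integral) (auto simp: iid_increments_def)
  also have "\<dots> = (\<integral>\<^sup>+ g. ennreal (pmf \<mu> g) * f g \<partial>count_space UNIV)"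
    using assms(1) by (subst nn_integral_count_space_indicator)
      (auto intro!: nn_integral_cong simp: indicator_def pmf_eq_0_set_pmf)
  also have "\<dots> = (\<integral>\<^sup>+ g. f g \<partial>measure_pmf \<mu>)"
    by (simp add: nn_integral_measure_pmf)
  finally show ?thesis .
qed

lemma random_walk_exp_moment_le:
  fixes len :: "'a \<Rightarrow> nat"
  assumes supp: "set_pmf \<mu> \<subseteq> carrier G"
    and one: "len \<one> = 0"
    and mult: "\<And>g h. g \<in> carrier G \<Longrightarrow> h \<in> carrier G \<Longrightarrow> len (g \<otimes> h) \<le> len g + len h"
    and u: "u \<ge> 0"
  shows "(\<integral>\<^sup>+ \<omega>. ennreal (exp (u * real (len (random_walk G X n \<omega>)))) \<partial>M) \<le>
    (\<integral>\<^sup>+ g. ennreal (exp (u * real (len g))) \<partial>measure_pmf \<mu>) ^ n"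
proof -
  interpret prob_space M using iid by (simp add: iid_increments_def)
  let ?f = "\<lambda>g. ennreal (exp (u * real (len g)))"
  have bound: "?f (random_walk G X n \<omega>) \<le> (\<Prod>i\<in>{1..n}. ?f (X i \<omega>))" if \<omega>: "\<omega> \<in> space M" for \<omega>
  proof (induction n)
    case 0
    show ?case by (simp add: one)
  next
    case (Suc n)
    have "random_walk G X n \<omega> \<in> carrier G" "X (Suc n) \<omega> \<in> carrier G"
      using measurable_space[OF random_walk_measurable \<omega>]
        measurable_space[OF increment_measurable \<omega>, of "Suc n"] by auto
    \<comment> \<open>Subadditivity is an upper bound on the length, and it passes through the
      exponential because u \<ge> 0.\<close>
    then have "u * real (len (random_walk G X (Suc n) \<omega>)) \<le>
        u * (real (len (random_walk G X n \<omega>)) + real (len (X (Suc n) \<omega>)))"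
      using mult u by (intro mult_left_mono) (auto simp flip: of_nat_add)
    then have "?f (random_walk G X (Suc n) \<omega>) \<le> ?f (random_walk G X n \<omega>) * ?f (X (Suc n) \<omega>)"
      by (auto simp: exp_add[symmetric] distrib_left simp flip: ennreal_mult intro!: ennreal_leI)
    also have "\<dots> \<le> (\<Prod>i\<in>{1..n}. ?f (X i \<omega>)) * ?f (X (Suc n) \<omega>)"
      by (intro mult_right_mono Suc) auto
    finally show ?case by simp
  qed
  have "(\<integral>\<^sup>+ \<omega>. ?f (random_walk G X n \<omega>) \<partial>M) \<le> (\<integral>\<^sup>+ \<omega>. (\<Prod>i\<in>{1..n}. ?f (X i \<omega>)) \<partial>M)"
    by (intro nn_integral_mono bound)
  also have "\<dots> = (\<Prod>i\<in>{1..n}. \<integral>\<^sup>+ \<omega>. ?f (X i \<omega>) \<partial>M)"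
  proof (intro indep_vars_nn_integral indep_vars_compose2[where Y="\<lambda>_. ?f"])
    show "indep_vars (\<lambda>_. count_space (carrier G)) X {1..n}"
      using iid by (auto simp: iid_increments_def intro: indep_vars_subset)
  qed auto
  also have "\<dots> = (\<integral>\<^sup>+ g. ?f g \<partial>measure_pmf \<mu>) ^ n"
    using nn_integral_increment[OF supp, of _ ?f] by simp
  finally show ?thesis .
qed

lemma sets_normalized_length_law [simp]:
  "sets (normalized_length_law M len (random_walk G X) n) = sets (borel_of nonneg_reals)"
  by (simp add: normalized_length_law_def)

text \<open>The factor n in the exponent cancels the normalization by n, which is why moments of the
  laws are written with exp(n (t y)).\<close>

lemma normalized_length_law_mgf:
  fixes len :: "'a \<Rightarrow> nat"
  assumes "n \<ge> 1"
  shows "(\<integral>\<^sup>+ y. ennreal (exp (real n * (t * y))) \<partial>normalized_length_law M len (random_walk G X) n) =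
    (\<integral>\<^sup>+ \<omega>. ennreal (exp (t * real (len (random_walk G X n \<omega>)))) \<partial>M)"
proof -
  have "(\<lambda>\<omega>. real (len (random_walk G X n \<omega>)) / real n) \<in> measurable M (borel_of nonneg_reals)"
    by (rule measurable_compose[OF random_walk_measurable]) auto
  moreover have "(\<lambda>y. ennreal (exp (real n * (t * y)))) \<in> borel_measurable (borel_of nonneg_reals)"
    by (rule measurable_compose[OF borel_measurable_borel_of[of _ "\<lambda>x. x"]]) auto
  ultimately show ?thesis
    using assms by (simp add: normalized_length_law_def nn_integral_distr)
qed

lemma normalized_length_law_moment_le:
  fixes len :: "'a \<Rightarrow> nat"
  assumes supp: "set_pmf \<mu> \<subseteq> carrier G"
    and one: "len \<one> = 0"
    and mult: "\<And>g h. g \<in> carrier G \<Longrightarrow> h \<in> carrier G \<Longrightarrow> len (g \<otimes> h) \<le> len g + len h"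
    and u: "u > 0"
    and fin: "(\<integral>\<^sup>+ g. ennreal (exp (u * real (len g))) \<partial>measure_pmf \<mu>) < \<infinity>"
  obtains b where "\<And>n. n \<ge> 1 \<Longrightarrow> (\<integral>\<^sup>+ y. ennreal (exp (real n * (u * y)))
      \<partial>normalized_length_law M len (random_walk G X) n) \<le> ennreal (exp (real n * b))"
proof -
  let ?C = "\<integral>\<^sup>+ g. ennreal (exp (u * real (len g))) \<partial>measure_pmf \<mu>"
  obtain r where r: "r \<ge> 0" "?C = ennreal r"
    using fin by (cases ?C) auto
  \<comment> \<open>The maximum with 1 keeps the argument of \<open>ln\<close> positive without a
    lower bound on \<open>r\<close>.\<close>
  define b where "b = ln (max r 1)"
  have "?C \<le> ennreal (exp b)" unfolding r(2) b_def by (intro ennreal_leI) simp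
  show ?thesis
  proof (rule that)
    fix n :: nat assume n: "n \<ge> 1"
    have "(\<integral>\<^sup>+ y. ennreal (exp (real n * (u * y))) \<partial>normalized_length_law M len (random_walk G X) n) \<le> ?C ^ n"
      unfolding normalized_length_law_mgf[OF n]
      using u by (intro random_walk_exp_moment_le supp one mult) auto
    also have "\<dots> \<le> ennreal (exp b) ^ n" by (intro power_mono) (fact, simp)
    also have "\<dots> = ennreal (exp (real n * b))" by (simp add: ennreal_power exp_of_nat_mult)
    finally show "(\<integral>\<^sup>+ y. ennreal (exp (real n * (u * y)))
      \<partial>normalized_length_law M len (random_walk G X) n) \<le> ennreal (exp (real n * b))" .
  qed
qed

lemma limiting_log_mgf_eq:
  fixes len :: "'a \<Rightarrow> nat"
  shows "limiting_log_mgf M len (random_walk G X) t = limsup (\<lambda>n. ereal (1 / real n) *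
    elog (\<integral>\<^sup>+ y. ennreal (exp (real n * (t * y))) \<partial>normalized_length_law M len (random_walk G X) n))"
  unfolding limiting_log_mgf_def
  by (intro Limsup_eq eventually_mono[OF eventually_ge_at_top[of 1]])
    (simp only: normalized_length_law_mgf)

end

end

theorem corollary1p2:
  fixes G :: "('a, 'b) monoid_scheme"
    and \<O> \<H> :: "'a set set"
    and S :: "'a set"
    and \<mu> :: "'a pmf"
    and M :: "'w measure"
    and X :: "nat \<Rightarrow> 'w \<Rightarrow> 'a"
    and I :: "real \<Rightarrow> ereal"
  assumes "group G"
    and "hyperbolic_relative_to G \<O>"
    and "non_elementary G"
    and "finite_generating_set G S"
    and "conj_representatives G \<O> \<H>"
    and "set_pmf \<mu> \<subseteq> carrier G"
    and "iid_increments G \<mu> M X"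
    and "admissible G M X"
    and "weak_ldp nonneg_reals
           (normalized_length_law M (word_length G S \<H>) (random_walk G X)) I"
    and "convex_rate I"
  shows "(finite_exponential_moment \<mu> (word_length G S \<H>) \<longrightarrow>
            proper_rate nonneg_reals I \<and>
            full_ldp nonneg_reals
              (normalized_length_law M (word_length G S \<H>) (random_walk G X)) I) \<and>
         (finite_moment_generating_function \<mu> (word_length G S \<H>) \<longrightarrow>
            (\<forall>x\<ge>0. I x =
               (SUP t::real. ereal (t * x) -
                  limiting_log_mgf M (word_length G S \<H>) (random_walk G X) t)))"
proof -
  interpret group G by fact
  note iid = \<open>iid_increments G \<mu> M X\<close>
  let ?len = "word_length G S \<H>"
  let ?\<nu> = "normalized_length_law M ?len (random_walk G X)"
  have S: "S \<subseteq> carrier G" "generate G S = carrier G"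
    using assms(4) by (auto simp: finite_generating_set_def)
  have \<H>: "\<Union>\<H> \<subseteq> carrier G"
  proof (rule Union_least)
    fix H assume "H \<in> \<H>"
    then have "subgroup H G"
      using assms(2,5)
      by (auto simp: hyperbolic_relative_to_def peripheral_collection_def conj_representatives_def)
    then show "H \<subseteq> carrier G" by (rule subgroup.subset)
  qed
  have countable: "countable (carrier G)"
    using countable_generate[OF S(1)] S(2) assms(4)
    by (simp add: finite_generating_set_def countable_finite)
  note sets = sets_normalized_length_law[OF iid countable, of ?len]
  have one: "?len \<one>\<^bsub>G\<^esub> = 0" by (simp add: word_length_def)
  note moment = normalized_length_law_moment_le[OF iid countable assms(6) one word_length_mult_le[OF S \<H>]]
  show ?thesis
  proof (intro conjI impI allI)
    assume "finite_exponential_moment \<mu> ?len"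
    then obtain u where u: "u > 0" "(\<integral>\<^sup>+ g. ennreal (exp (u * real (?len g))) \<partial>measure_pmf \<mu>) < \<infinity>"
      by (auto simp: finite_exponential_moment_def)
    obtain b where b: "\<And>n. n \<ge> 1 \<Longrightarrow> (\<integral>\<^sup>+ y. ennreal (exp (real n * (u * y))) \<partial>?\<nu> n) \<le> ennreal (exp (real n * b))"
      using moment[OF _ _ u] by blast
    have tight: "exponentially_tight nonneg_reals ?\<nu>"
      by (rule exp_moment_exponentially_tight[OF sets b u(1)])
    have "locally_compact_space nonneg_reals"
      by (intro locally_compact_space_closed_subset locally_compact_space_euclidean) auto
    moreover have "Hausdorff_space nonneg_reals"
      by (simp add: Hausdorff_space_subtopology)
    ultimately show "proper_rate nonneg_reals I" "full_ldp nonneg_reals ?\<nu> I"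
      using proper_rate_if_exponentially_tight[OF _ _ sets assms(9) tight]
        full_ldp_if_exponentially_tight[OF _ _ sets assms(9) tight] by simp_all
  next
    fix x :: real
    assume mgf: "finite_moment_generating_function \<mu> ?len" and x: "0 \<le> x"
    have tail: "\<exists>R. limsup (\<lambda>n. ereal (1 / real n) *
        elog (\<integral>\<^sup>+ y. ennreal (exp (real n * (t * y))) * indicator {R<..} y \<partial>?\<nu> n)) \<le> ereal c" for t c
    proof -
      \<comment> \<open>Any order that is positive and exceeds \<open>t\<close> would do, the first
        for the moment hypothesis, the second for the tail bound.\<close>
      let ?u = "\<bar>t\<bar> + 1"
      have u: "?u > 0" "(\<integral>\<^sup>+ g. ennreal (exp (?u * real (?len g))) \<partial>measure_pmf \<mu>) < \<infinity>"
        using mgf by (auto simp: finite_moment_generating_function_def)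
      obtain b where b: "\<And>n. n \<ge> 1 \<Longrightarrow> (\<integral>\<^sup>+ y. ennreal (exp (real n * (?u * y))) \<partial>?\<nu> n) \<le> ennreal (exp (real n * b))"
        using moment[OF _ _ u] by blast
      show ?thesis by (rule exp_moment_tail[OF sets b]) auto
    qed
    show "I x = (SUP t::real. ereal (t * x) - limiting_log_mgf M ?len (random_walk G X) t)"
      unfolding limiting_log_mgf_eq[OF iid countable]
      by (rule rate_eq_legendre[OF sets assms(9,10) tail x])
  qed
qed

end
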